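(* For every fixed integer $r\geq 2$ and every graph $G$ of maximum degree $\Delta$ with minimum degree $\delta(G)\geq r+2$ and without isolated edges, $$\chi'_{a,r}(G)\leq (1+o(1))\Delta,$$ where the $o(1)$ term tends to $0$ as $\Delta\to\infty$ (with $r$ fixed). Explicitly: for every integer $r\geq 2$ and every real $\eta>0$ there exists $\Delta_0$ such that every graph $G$ without isolated edges, with $\delta(G)\geq r+2$ and maximum degree $\Delta\geq\Delta_0$, satisfies $\chi'_{a,r}(G)\leq (1+\eta)\Delta$.
   Context: All graphs are finite and simple. An isolated edge of $G$ is a connected component of $G$ isomorphic to $K_2$. $\delta(G)$ and $\Delta(G)$ denote the minimum and maximum degree of $G$, and $d(u,v)$ denotes the distance between vertices $u,v$ in $G$ (infinite if they lie in different components). For a proper edge colouring $c:E(G)\to\{1,2,\ldots,k\}$ (edges sharing an end receive distinct colours) and a vertex $v$, let $S_c(v)=\{c(uv):u\in N(v)\}$ be the set of colours on edges incident with $v$, where $N(v)$ is the set of neighbours of $v$. For a positive integer $r$ and a graph $G$ without isolated edges, $\chi'_{a,r}(G)$ (the $r$-adjacent strong chromatic index) is the least $k$ for which there is a proper edge colouring $c:E(G)\to\{1,\ldots,k\}$ such that $S_c(u)\neq S_c(v)$ for every pair of vertices $u,v$ with $1\leq d(u,v)\leq r$. *)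

theory Defs
  imports Complex_Main "HOL-Library.Extended_Nat"
begin

record 'a graph =
  verts :: "'a set"
  edges :: "'a set set"

text \<open>The vertex set is taken to be nonempty, so that the minimum and the maximum degree exist.\<close>

definition simple_graph :: "'a graph \<Rightarrow> bool" where
  "simple_graph G \<longleftrightarrow>
     finite (verts G) \<and> verts G \<noteq> {} \<and> (\<forall>e\<in>edges G. e \<subseteq> verts G \<and> card e = 2)"

definition neighbours :: "'a graph \<Rightarrow> 'a \<Rightarrow> 'a set" where
  "neighbours G v = {u. {u, v} \<in> edges G}"

definition degree :: "'a graph \<Rightarrow> 'a \<Rightarrow> nat" where
  "degree G v = card (neighbours G v)"

definition min_degree :: "'a graph \<Rightarrow> nat" where
  "min_degree G = Min (degree G ` verts G)"

definition max_degree :: "'a graph \<Rightarrow> nat" where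
  "max_degree G = Max (degree G ` verts G)"

definition walk :: "'a graph \<Rightarrow> 'a list \<Rightarrow> bool" where
  "walk G p \<longleftrightarrow> p \<noteq> [] \<and> set p \<subseteq> verts G \<and> successively (\<lambda>x y. {x, y} \<in> edges G) p"

text \<open>A walk on the vertex list \<open>p\<close> has \<open>length p - 1\<close> edges, and the infimum of the
  empty set in \<^typ>\<open>enat\<close> is \<open>\<infinity>\<close>.\<close>

definition distance :: "'a graph \<Rightarrow> 'a \<Rightarrow> 'a \<Rightarrow> enat" where
  "distance G u v = Inf {enat (length p - 1) | p. walk G p \<and> hd p = u \<and> last p = v}"

definition induced_subgraph :: "'a graph \<Rightarrow> 'a set \<Rightarrow> 'a graph" where
  "induced_subgraph G W = \<lparr>verts = W, edges = {e \<in> edges G. e \<subseteq> W}\<rparr>"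

definition components :: "'a graph \<Rightarrow> 'a graph set" where
  "components G =
     {induced_subgraph G {w \<in> verts G. distance G v w \<noteq> \<infinity>} | v. v \<in> verts G}"

definition is_K2 :: "'a graph \<Rightarrow> bool" where
  "is_K2 H \<longleftrightarrow> (\<exists>u v. u \<noteq> v \<and> verts H = {u, v} \<and> edges H = {{u, v}})"

definition has_isolated_edge :: "'a graph \<Rightarrow> bool" where
  "has_isolated_edge G \<longleftrightarrow> (\<exists>H\<in>components G. is_K2 H)"

definition proper_edge_colouring :: "'a graph \<Rightarrow> nat \<Rightarrow> ('a set \<Rightarrow> nat) \<Rightarrow> bool" where
  "proper_edge_colouring G k c \<longleftrightarrow>
     (\<forall>e\<in>edges G. c e \<in> {1..k}) \<and>
     (\<forall>e\<in>edges G. \<forall>f\<in>edges G. e \<noteq> f \<and> e \<inter> f \<noteq> {} \<longrightarrow> c e \<noteq> c f)"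

definition colours_at :: "'a graph \<Rightarrow> ('a set \<Rightarrow> nat) \<Rightarrow> 'a \<Rightarrow> nat set" where
  "colours_at G c v = {c {u, v} | u. u \<in> neighbours G v}"

definition distinguishes :: "nat \<Rightarrow> 'a graph \<Rightarrow> ('a set \<Rightarrow> nat) \<Rightarrow> bool" where
  "distinguishes r G c \<longleftrightarrow>
     (\<forall>u\<in>verts G. \<forall>v\<in>verts G.
        1 \<le> distance G u v \<and> distance G u v \<le> enat r \<longrightarrow> colours_at G c u \<noteq> colours_at G c v)"

text \<open>The \<open>LEAST\<close> below is only meaningful if some \<open>k\<close> admits a suitable colouring. This is
  the case for every graph without isolated edges: see \<open>ex_distinguishing_colouring\<close>.\<close>

definition adj_strong_chromatic_index :: "nat \<Rightarrow> 'a graph \<Rightarrow> nat" where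
  "adj_strong_chromatic_index r G =
     (LEAST k. \<exists>c. proper_edge_colouring G k c \<and> distinguishes r G c)"

lemma walk_stays:
  assumes "walk G p" "hd p \<in> W"
    and closed: "\<And>x y. x \<in> W \<Longrightarrow> {x, y} \<in> edges G \<Longrightarrow> y \<in> W"
  shows "set p \<subseteq> W"
  using assms(1,2)
proof (induction p)
  case (Cons a p)
  show ?case
  proof (cases p)
    case (Cons b q)
    then have "walk G p" "{a, b} \<in> edges G"
      using Cons.prems by (auto simp: walk_def)
    moreover have "b \<in> W" using closed Cons.prems(2) \<open>{a, b} \<in> edges G\<close> by auto
    ultimately show ?thesis using Cons.IH Cons.prems(2) Cons by auto
  qed (use Cons.prems in auto)
qed simp

lemma distance_finiteD:
  assumes "distance G u v \<noteq> \<infinity>"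
  obtains p where "walk G p" "hd p = u" "last p = v"
  using assms unfolding distance_def
  by (cases "{enat (length p - 1) | p. walk G p \<and> hd p = u \<and> last p = v} = {}")
     (auto simp: Inf_enat_def)

lemma distance_le_walk:
  "walk G p \<Longrightarrow> distance G (hd p) (last p) \<le> enat (length p - 1)"
  unfolding distance_def by (rule Inf_lower) auto

lemma ex_distinguishing_colouring:
  assumes G: "simple_graph G" and iso: "\<not> has_isolated_edge G"
  shows "\<exists>k c. proper_edge_colouring G k c \<and> distinguishes r G c"
proof -
  have "edges G \<subseteq> Pow (verts G)" "finite (verts G)"
    using G by (auto simp: simple_graph_def)
  then have "finite (edges G)" using finite_subset by blast
  then obtain c where c: "bij_betw c (edges G) {1..card (edges G)}"
    using finite_same_card_bij[of "edges G" "{1..card (edges G)}"] by auto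
  then have inj: "inj_on c (edges G)" by (simp add: bij_betw_def)
  have "proper_edge_colouring G (card (edges G)) c"
    unfolding proper_edge_colouring_def
    using bij_betwE[OF c] inj by (auto dest: inj_onD)
  moreover have "distinguishes r G c"
    unfolding distinguishes_def
  proof (intro ballI impI notI)
    fix u v
    assume u: "u \<in> verts G" and v: "v \<in> verts G"
      and d: "1 \<le> distance G u v \<and> distance G u v \<le> enat r"
      and S: "colours_at G c u = colours_at G c v"
    have "walk G [u]" using u by (simp add: walk_def)
    from distance_le_walk[OF this] have "distance G u u = 0"
      by (simp add: zero_enat_def[symmetric])
    with d have uv: "u \<noteq> v" by auto
    have only: "y = b" if xy: "{x, y} \<in> edges G" "x = a" and ab: "a \<noteq> b"
      "colours_at G c a = colours_at G c b" for x y a b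
    proof -
      have ya: "{y, a} \<in> edges G" using xy by (simp add: insert_commute)
      then have "c {y, a} \<in> colours_at G c a"
        unfolding colours_at_def neighbours_def by blast
      then obtain z where "{z, b} \<in> edges G" "c {y, a} = c {z, b}"
        using ab(2) by (auto simp: colours_at_def neighbours_def)
      with ya inj have "{y, a} = {z, b}" by (auto dest: inj_onD)
      with ab(1) show "y = b" by (auto simp: doubleton_eq_iff)
    qed
    have closed: "y \<in> {u, v}" if "x \<in> {u, v}" "{x, y} \<in> edges G" for x y
    proof (cases "x = u")
      case True
      from only[OF that(2) True uv S] show ?thesis by simp
    next
      case False
      with that(1) have "x = v" by simp
      from only[OF that(2) this uv[symmetric] S[symmetric]] show ?thesis by simp
    qed
    have "distance G u v \<noteq> \<infinity>" using d by (cases "distance G u v") auto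
    then obtain p where p: "walk G p" "hd p = u" "last p = v"
      by (rule distance_finiteD)
    have "p \<noteq> []" using p by (simp add: walk_def)
    then obtain q where q: "p = u # q" using p by (cases p) auto
    with p uv obtain w q' where "q = w # q'" by (cases q) auto
    with q p have "{u, w} \<in> edges G" by (simp add: walk_def)
    with only[OF this refl uv S] have e: "{u, v} \<in> edges G" by auto
    have "walk G [u, v]" using e u v by (simp add: walk_def)
    from distance_le_walk[OF this] have "distance G u v \<noteq> \<infinity>"
      by (cases "distance G u v") auto
    moreover have "w \<in> {u, v}" if fin: "distance G u w \<noteq> \<infinity>" for w
    proof -
      obtain p where "walk G p" "hd p = u" "last p = w"
        using fin by (rule distance_finiteD)
      note w = this
      have "set p \<subseteq> {u, v}"
        by (rule walk_stays[OF w(1)]) (use w(2) in simp, erule (1) closed)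
      moreover have "last p \<in> set p" using w(1) by (simp add: walk_def)
      ultimately show ?thesis using w(3) by blast
    qed
    ultimately have W: "{w \<in> verts G. distance G u w \<noteq> \<infinity>} = {u, v}"
      using u v \<open>distance G u u = 0\<close> by (auto simp: zero_enat_def)
    have "f = {u, v}" if "f \<in> edges G" "f \<subseteq> {u, v}" for f
      using that G uv by (intro card_subset_eq) (auto simp: simple_graph_def)
    then have "is_K2 (induced_subgraph G {u, v})"
      unfolding is_K2_def induced_subgraph_def using uv e
      by (intro exI[of _ u] exI[of _ v]) auto
    then have "has_isolated_edge G"
      unfolding has_isolated_edge_def components_def using u W by force
    with iso show False by simp
  qed
  ultimately show ?thesis by blast
qed

end

theory Submission
  imports Defs "HOL-Combinatorics.Permutations" "HOL-Real_Asymp.Real_Asymp"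
begin

text \<open>
  The edges are split at random into \<open>m\<close> classes, where \<open>m\<close> is about \<open>\<Delta> / (ln \<Delta>)\<^sup>2\<close>, and each class is
  coloured from a palette of its own. With high probability a vertex \<open>v\<close> has at most
  \<open>(1 + \<epsilon>) * (ln \<Delta>)\<^sup>2\<close> edges in a class, and then by Vizing's theorem (\<open>vizing\<close>) palettes of
  \<open>(1 + \<epsilon>) * (ln \<Delta>)\<^sup>2 + 1\<close> colours are enough, which is \<open>(1 + \<epsilon> + o(1)) * \<Delta>\<close> colours in total. The
  randomness lies only in the choice of the palettes; the colouring inside a class may be arbitrary.

  Two vertices \<open>u\<close> and \<open>v\<close> are distinguished as soon as the classes of their edges form different multisets
  (\<open>colouring_from_split\<close>). If \<open>u\<close> has at least \<open>j\<close> edges that do not end in \<open>v\<close>, then conditioning on the classes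
  of all edges but \<open>j\<close> of these shows that the multisets agree with probability at most \<open>fact j / m ^ j\<close>
  (\<open>card_clash_le\<close>). The minimum degree allows \<open>j = r + 2\<close>, or \<open>j = r + 1\<close> if \<open>u\<close> and \<open>v\<close> are adjacent.

  The Lovasz Local Lemma (\<open>lovasz_local_product\<close>) makes it possible to avoid all overfull classes and all
  clashes between vertices at distance at most \<open>r\<close> simultaneously. An event looks at no more than
  \<open>2 * \<Delta>\<close> edges, and the end of an edge takes part in at most \<open>r * \<Delta> ^ r\<close> pairs, at most \<open>\<Delta>\<close> of which are
  adjacent. Up to powers of \<open>ln \<Delta>\<close>, the clashes that influence a given event therefore have total
  probability \<open>\<Delta> * \<Delta> ^ r / \<Delta> ^ (r + 2) + \<Delta> * \<Delta> / \<Delta> ^ (r + 1)\<close>, which tends to 0 because \<open>r \<ge> 2\<close>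
  (\<open>ex_distinguishing_split\<close>, \<open>eventually_split_sizes\<close>).
\<close>

section \<open>Vizing's theorem\<close>

text \<open>Colourings of a bare edge set, with colours below \<open>k\<close>: the proof of Vizing's theorem adds and
  removes edges all the time, so a fixed vertex set would only be in the way.\<close>

definition proper_on :: "'v set set \<Rightarrow> nat \<Rightarrow> ('v set \<Rightarrow> nat) \<Rightarrow> bool" where
  "proper_on F k c \<longleftrightarrow>
     (\<forall>e\<in>F. c e < k) \<and> (\<forall>e\<in>F. \<forall>f\<in>F. e \<inter> f \<noteq> {} \<longrightarrow> c e = c f \<longrightarrow> e = f)"

definition missing :: "'v set set \<Rightarrow> ('v set \<Rightarrow> nat) \<Rightarrow> 'v \<Rightarrow> nat \<Rightarrow> bool" where
  "missing F c v \<gamma> \<longleftrightarrow> (\<forall>e\<in>F. v \<in> e \<longrightarrow> c e \<noteq> \<gamma>)"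

lemma proper_onD: "proper_on F k c \<Longrightarrow> e \<in> F \<Longrightarrow> f \<in> F \<Longrightarrow> v \<in> e \<Longrightarrow> v \<in> f \<Longrightarrow> c e = c f \<Longrightarrow> e = f"
  by (auto simp: proper_on_def)

lemma proper_on_unique_neighbour:
  "proper_on F k c \<Longrightarrow> {v, w} \<in> F \<Longrightarrow> {v, w'} \<in> F \<Longrightarrow> c {v, w} = c {v, w'} \<Longrightarrow> w = w'"
  by (drule proper_onD[where v = v and e = "{v, w}" and f = "{v, w'}"]) (auto simp: doubleton_eq_iff)

lemma proper_on_insert:
  assumes c: "proper_on F k c" and "\<gamma> < k" and "missing F c x \<gamma>" "missing F c y \<gamma>"
    and "{x, y} \<notin> F"
  shows "proper_on (insert {x, y} F) k (c({x, y} := \<gamma>))"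
  using assms unfolding proper_on_def missing_def
  by (auto simp: disjoint_iff)

lemma ex_missing:
  assumes "finite F" "card {e \<in> F. v \<in> e} < k"
  obtains \<gamma> where "\<gamma> < k" "missing F c v \<gamma>"
proof -
  have "card (c ` {e \<in> F. v \<in> e}) < k"
    using card_image_le[of "{e \<in> F. v \<in> e}" c] assms by auto
  then have "\<not> {..<k} \<subseteq> c ` {e \<in> F. v \<in> e}"
    using card_mono[of "c ` {e \<in> F. v \<in> e}" "{..<k}"] assms(1) by auto
  then show ?thesis using that by (auto simp: missing_def)
qed

subsection \<open>Kempe components\<close>

text \<open>Swapping two colours \<open>\<alpha>\<close> and \<open>\<beta>\<close> on one connected component of the subgraph that they form keeps
  a colouring proper and exchanges the roles of \<open>\<alpha>\<close> and \<open>\<beta>\<close> exactly at the vertices of that component.\<close>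

definition two_coloured :: "'v set set \<Rightarrow> ('v set \<Rightarrow> nat) \<Rightarrow> nat \<Rightarrow> nat \<Rightarrow> ('v \<times> 'v) set" where
  "two_coloured F c \<alpha> \<beta> = {(v, w). {v, w} \<in> F \<and> c {v, w} \<in> {\<alpha>, \<beta>}}"

definition kempe :: "'v set set \<Rightarrow> ('v set \<Rightarrow> nat) \<Rightarrow> nat \<Rightarrow> nat \<Rightarrow> 'v \<Rightarrow> 'v set" where
  "kempe F c \<alpha> \<beta> z = (two_coloured F c \<alpha> \<beta>)\<^sup>* `` {z}"

lemma sym_two_coloured: "sym (two_coloured F c \<alpha> \<beta>)"
  by (auto simp: two_coloured_def sym_def insert_commute)

lemma kempe_sym: "w \<in> kempe F c \<alpha> \<beta> z \<Longrightarrow> z \<in> kempe F c \<alpha> \<beta> w"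
  using sym_rtrancl[OF sym_two_coloured] by (metis Image_singleton_iff kempe_def symD)

lemma kempe_trans: "w \<in> kempe F c \<alpha> \<beta> z \<Longrightarrow> u \<in> kempe F c \<alpha> \<beta> w \<Longrightarrow> u \<in> kempe F c \<alpha> \<beta> z"
  by (auto simp: kempe_def)

lemma kempe_self: "z \<in> kempe F c \<alpha> \<beta> z"
  by (simp add: kempe_def)

lemma kempe_closed:
  assumes "e \<in> F" "card e = 2" "c e \<in> {\<alpha>, \<beta>}" "v \<in> e" "v \<in> kempe F c \<alpha> \<beta> z"
  shows "e \<subseteq> kempe F c \<alpha> \<beta> z"
proof
  fix w assume w: "w \<in> e"
  show "w \<in> kempe F c \<alpha> \<beta> z"
  proof (cases "w = v")
    case False
    then have "e = {v, w}" using assms w by (auto simp: card_2_iff)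
    then have "(v, w) \<in> two_coloured F c \<alpha> \<beta>" using assms by (simp add: two_coloured_def)
    with assms(5) show ?thesis unfolding kempe_def by (auto intro: rtrancl_into_rtrancl)
  qed (use assms in simp)
qed

definition kempe_swap :: "'v set set \<Rightarrow> ('v set \<Rightarrow> nat) \<Rightarrow> nat \<Rightarrow> nat \<Rightarrow> 'v \<Rightarrow> 'v set \<Rightarrow> nat" where
  "kempe_swap F c \<alpha> \<beta> z e =
     (if e \<subseteq> kempe F c \<alpha> \<beta> z then transpose \<alpha> \<beta> (c e) else c e)"

text \<open>Every edge at \<open>v\<close> with colour \<open>\<alpha>\<close> or \<open>\<beta>\<close> lies inside the component as soon as \<open>v\<close> does, and the
  other colours are fixed by the transposition; so the swap can be decided by looking at \<open>v\<close> alone.\<close>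

lemma kempe_swap_at:
  assumes "e \<in> F" "card e = 2" "v \<in> e"
  shows "kempe_swap F c \<alpha> \<beta> z e = (if v \<in> kempe F c \<alpha> \<beta> z then transpose \<alpha> \<beta> (c e) else c e)"
proof (cases "c e \<in> {\<alpha>, \<beta>}")
  case True
  then have "v \<in> kempe F c \<alpha> \<beta> z \<Longrightarrow> e \<subseteq> kempe F c \<alpha> \<beta> z"
    using kempe_closed[of e F c \<alpha> \<beta> v] assms by blast
  then show ?thesis using assms(3) by (auto simp: kempe_swap_def)
qed (simp add: kempe_swap_def)

lemma proper_on_kempe_swap:
  assumes c: "proper_on F k c" and F: "\<And>e. e \<in> F \<Longrightarrow> card e = 2" and "\<alpha> < k" "\<beta> < k"
  shows "proper_on F k (kempe_swap F c \<alpha> \<beta> z)"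
  unfolding proper_on_def
proof (intro conjI ballI impI)
  fix e assume "e \<in> F"
  then show "kempe_swap F c \<alpha> \<beta> z e < k"
    using c assms(3,4) by (auto simp: kempe_swap_def proper_on_def transpose_def)
next
  fix e f
  assume ef: "e \<in> F" "f \<in> F" "e \<inter> f \<noteq> {}" and eq: "kempe_swap F c \<alpha> \<beta> z e = kempe_swap F c \<alpha> \<beta> z f"
  then obtain v where v: "v \<in> e" "v \<in> f" by blast
  have "c e = c f"
    using eq kempe_swap_at[OF ef(1) F[OF ef(1)] v(1), of c \<alpha> \<beta> z]
      kempe_swap_at[OF ef(2) F[OF ef(2)] v(2), of c \<alpha> \<beta> z]
    by (cases "v \<in> kempe F c \<alpha> \<beta> z") (simp_all add: inj_eq[OF inj_transpose])
  with c ef v show "e = f" by (auto dest: proper_onD)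
qed

lemma missing_kempe_swap:
  assumes "\<And>e. e \<in> F \<Longrightarrow> card e = 2"
  shows "missing F (kempe_swap F c \<alpha> \<beta> z) v \<gamma> \<longleftrightarrow>
    missing F c v (if v \<in> kempe F c \<alpha> \<beta> z then transpose \<alpha> \<beta> \<gamma> else \<gamma>)"
proof -
  have "kempe_swap F c \<alpha> \<beta> z e \<noteq> \<gamma> \<longleftrightarrow>
      c e \<noteq> (if v \<in> kempe F c \<alpha> \<beta> z then transpose \<alpha> \<beta> \<gamma> else \<gamma>)"
    if "e \<in> F" "v \<in> e" for e
    using kempe_swap_at[OF that(1) assms[OF that(1)] that(2), of c \<alpha> \<beta> z]
    by (cases "v \<in> kempe F c \<alpha> \<beta> z") (auto simp: transpose_def)
  then show ?thesis unfolding missing_def by blast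
qed

text \<open>\<open>alternating F c \<alpha> \<beta> x n w\<close>: the walk from \<open>x\<close> that uses the colours \<open>\<beta>, \<alpha>, \<beta>, \<dots>\<close> in turn is at \<open>w\<close>
  after \<open>n\<close> steps. As the colouring is proper, this walk is unique; when \<open>\<alpha>\<close> is missing at \<open>x\<close>, it
  sweeps out the whole component of \<open>x\<close>.\<close>

inductive alternating ::
    "'v set set \<Rightarrow> ('v set \<Rightarrow> nat) \<Rightarrow> nat \<Rightarrow> nat \<Rightarrow> 'v \<Rightarrow> nat \<Rightarrow> 'v \<Rightarrow> bool"
  for F c \<alpha> \<beta> x where
  start: "alternating F c \<alpha> \<beta> x 0 x"
| step: "alternating F c \<alpha> \<beta> x n w \<Longrightarrow> {w, w'} \<in> F \<Longrightarrow> c {w, w'} = (if even n then \<beta> else \<alpha>) \<Longrightarrow>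
    alternating F c \<alpha> \<beta> x (Suc n) w'"

lemma alternating_unique:
  assumes "proper_on F k c" "alternating F c \<alpha> \<beta> x n w" "alternating F c \<alpha> \<beta> x n w'"
  shows "w = w'"
  using assms(2,3)
proof (induction arbitrary: w')
  case start
  then show ?case by (auto elim: alternating.cases)
next
  case (step n w v)
  from step.prems obtain u where u: "alternating F c \<alpha> \<beta> x n u" "{u, w'} \<in> F"
      "c {u, w'} = (if even n then \<beta> else \<alpha>)"
    by (auto elim: alternating.cases)
  with step.IH have "u = w" by blast
  with u step.hyps proper_on_unique_neighbour[OF assms(1)] show ?case by metis
qed

lemma kempe_alternating:
  assumes c: "proper_on F k c" and x: "missing F c x \<alpha>" and w: "w \<in> kempe F c \<alpha> \<beta> x"
  shows "\<exists>n. alternating F c \<alpha> \<beta> x n w"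
proof -
  have "(x, w) \<in> (two_coloured F c \<alpha> \<beta>)\<^sup>*" using w by (simp add: kempe_def)
  then show ?thesis
  proof (induction rule: rtrancl_induct)
    case base
    show ?case by (blast intro: alternating.start)
  next
    case (step v w)
    then obtain n where n: "alternating F c \<alpha> \<beta> x n v" by blast
    have e: "{v, w} \<in> F" "c {v, w} = \<alpha> \<or> c {v, w} = \<beta>"
      using step by (auto simp: two_coloured_def)
    show ?case
    proof (cases "c {v, w} = (if even n then \<beta> else \<alpha>)")
      case True
      with n e show ?thesis by (blast intro: alternating.step)
    next
      case False
      \<comment> \<open>The edge has the colour by which the walk came to \<open>v\<close>, so it leads back to the previous vertex.\<close>
      with e have col: "c {v, w} = (if even n then \<alpha> else \<beta>)" by (auto split: if_splits)
      from n show ?thesis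
      proof cases
        case start
        with col e x show ?thesis by (auto simp: missing_def)
      next
        case (step m u)
        then have "{v, u} \<in> F" "c {v, u} = c {v, w}" using col by (auto simp: insert_commute)
        with e c have "u = w" by (metis proper_on_unique_neighbour)
        with step show ?thesis by blast
      qed
    qed
  qed
qed

text \<open>A two-coloured component is a path or a cycle, so besides its end \<open>x\<close> it has at most one other end.
  In terms of the walk from \<open>x\<close>: it enters a vertex at which \<open>\<beta>\<close> is missing by \<open>\<alpha>\<close>, must leave it
  by \<open>\<beta>\<close>, and therefore stops there. Two such vertices would both be the last one.\<close>

lemma kempe_two_ends:
  assumes c: "proper_on F k c" and x: "missing F c x \<alpha>"
    and a: "missing F c a \<beta>" "a \<in> kempe F c \<alpha> \<beta> x" "a \<noteq> x"
    and b: "missing F c b \<beta>" "b \<in> kempe F c \<alpha> \<beta> x" "b \<noteq> x"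
  shows "a = b"
proof -
  have last: "m \<le> n" if av: "missing F c v \<beta>" "v \<noteq> x" "alternating F c \<alpha> \<beta> x n v"
    and w: "alternating F c \<alpha> \<beta> x m w" for v w n m
  proof (rule ccontr)
    assume "\<not> m \<le> n"
    have "\<exists>u. {v, u} \<in> F \<and> c {v, u} = (if even n then \<beta> else \<alpha>)"
      using w \<open>\<not> m \<le> n\<close>
    proof (induction)
      case (step j w w')
      show ?case
      proof (cases "j = n")
        case True
        with step.hyps alternating_unique[OF c av(3)] show ?thesis by blast
      qed (use step in simp)
    qed simp
    then obtain u where u: "{v, u} \<in> F" "c {v, u} = (if even n then \<beta> else \<alpha>)" by blast
    with av(1) have "odd n" by (auto simp: missing_def split: if_splits)
    from av(3) show False
    proof cases
      case start
      with av show False by simp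
    next
      case (step j t)
      with \<open>odd n\<close> av(1) show False by (auto simp: missing_def)
    qed
  qed
  obtain n m where nm: "alternating F c \<alpha> \<beta> x n a" "alternating F c \<alpha> \<beta> x m b"
    using kempe_alternating[OF c x] a b by blast
  have "n = m"
    using last[OF a(1,3) nm] last[OF b(1,3) nm(2,1)] by simp
  then show ?thesis using alternating_unique[OF c nm(1)] nm(2) by simp
qed

subsection \<open>Fans and Vizing's theorem\<close>

text \<open>A fan at \<open>x\<close>: the first spoke \<open>{x, hd ys}\<close> is still uncoloured, and the colour of every later spoke is
  missing at the previous leaf. Hence all spokes can hand their colour to the spoke before them.\<close>

definition fan :: "'v set set \<Rightarrow> ('v set \<Rightarrow> nat) \<Rightarrow> 'v \<Rightarrow> 'v list \<Rightarrow> bool" where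
  "fan F c x ys \<longleftrightarrow> ys \<noteq> [] \<and> distinct ys \<and> {x, hd ys} \<notin> F \<and> x \<noteq> hd ys \<and>
     (\<forall>y\<in>set (tl ys). {x, y} \<in> F) \<and>
     (\<forall>i. Suc i < length ys \<longrightarrow> missing F c (ys ! i) (c {x, ys ! Suc i}))"

text \<open>Rotating the fan moves the uncoloured edge from its first to its last spoke; if one colour is missing at
  both ends of the last spoke, that edge can be coloured too. One step of the rotation colours the first
  spoke with the colour of the second, which becomes the uncoloured first spoke of a shorter fan.\<close>

lemma fan_rotate:
  assumes "fan F c x ys" "proper_on F k c" "\<alpha> < k" "missing F c x \<alpha>" "missing F c (last ys) \<alpha>"
    and "\<And>e. e \<in> F \<Longrightarrow> card e = 2"
  shows "\<exists>c'. proper_on (insert {x, hd ys} F) k c'"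
  using assms
proof (induction ys arbitrary: F c)
  case (Cons y ys)
  note fan = Cons.prems(1)[unfolded fan_def]
  show ?case
  proof (cases ys)
    case Nil
    then show ?thesis
      using proper_on_insert[OF Cons.prems(2,3,4), of y] Cons.prems(5) fan by auto
  next
    case (Cons z zs)
    define \<gamma> where "\<gamma> = c {x, z}"
    have xz: "{x, z} \<in> F" and xy: "{x, y} \<notin> F" using fan Cons by auto
    have "x \<noteq> z" using Cons.prems(6)[OF xz] by auto
    have "y \<noteq> z" "y \<notin> set zs" "z \<notin> set zs" using fan Cons by auto
    have y: "missing F c y \<gamma>" using fan Cons by (auto simp: \<gamma>_def dest: spec[of _ 0])
    have "\<gamma> < k" using Cons.prems(2) xz by (auto simp: proper_on_def \<gamma>_def)
    define F' where "F' = insert {x, y} (F - {{x, z}})"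
    define c' where "c' = c({x, y} := \<gamma>)"
    have F'_le: "proper_on (F - {{x, z}}) k c"
      using Cons.prems(2) by (auto simp: proper_on_def)
    have miss: "missing (F - {{x, z}}) c v \<delta>" if "missing F c v \<delta>" for v \<delta>
      using that by (auto simp: missing_def)
    have x\<gamma>: "missing (F - {{x, z}}) c x \<gamma>"
      unfolding missing_def
    proof (intro ballI impI notI)
      fix e assume "e \<in> F - {{x, z}}" "x \<in> e" "c e = \<gamma>"
      with proper_onD[OF Cons.prems(2) _ xz, of e x] show False by (auto simp: \<gamma>_def)
    qed
    have c': "proper_on F' k c'"
      unfolding F'_def c'_def
      using proper_on_insert[OF F'_le \<open>\<gamma> < k\<close> x\<gamma> miss[OF y]] xy by simp
    have miss': "missing F' c' v \<delta>" if "missing F c v \<delta>" "v \<noteq> y" "v = x \<Longrightarrow> \<delta> \<noteq> \<gamma>" for v \<delta>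
      using that xy by (auto simp: missing_def F'_def c'_def)
    have \<alpha>\<gamma>: "\<alpha> \<noteq> \<gamma>" using Cons.prems(4) xz by (auto simp: missing_def \<gamma>_def)
    have ys_neq: "v \<noteq> x" if "v \<in> set ys" for v
      using that fan Cons.prems(6)[of "{x, v}"] by auto
    have "fan F' c' x ys"
      unfolding fan_def
    proof (intro conjI ballI allI impI)
      show "ys \<noteq> []" "distinct ys" "x \<noteq> hd ys" using fan Cons \<open>x \<noteq> z\<close> by auto
      show "{x, hd ys} \<notin> F'"
        using \<open>y \<noteq> z\<close> Cons by (auto simp: F'_def doubleton_eq_iff)
      show "{x, v} \<in> F'" if "v \<in> set (tl ys)" for v
        using that fan Cons by (auto simp: F'_def doubleton_eq_iff)
      fix i assume i: "Suc i < length ys"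
      then have "missing F c (ys ! i) (c {x, ys ! Suc i})" using fan by (auto dest: spec[of _ "Suc i"])
      moreover have "ys ! i \<in> set ys" "ys ! Suc i \<in> set ys" using i by auto
      moreover have "y \<notin> set ys" using fan by simp
      ultimately show "missing F' c' (ys ! i) (c' {x, ys ! Suc i})"
        using miss'[of "ys ! i" "c {x, ys ! Suc i}"] ys_neq[of "ys ! i"]
        by (auto simp: c'_def doubleton_eq_iff)
    qed
    moreover have "missing F' c' x \<alpha>"
      using miss'[OF Cons.prems(4)] \<alpha>\<gamma> fan by auto
    moreover have "missing F' c' (last ys) \<alpha>"
    proof -
      have "last ys \<in> set ys" "y \<notin> set ys" using Cons fan by auto
      then show ?thesis
        using miss'[of "last ys" \<alpha>] Cons.prems(5) ys_neq[of "last ys"] Cons by (metis last.simps list.distinct(1))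
    qed
    moreover have "card e = 2" if "e \<in> F'" for e
      using that Cons.prems(6) fan by (auto simp: F'_def)
    ultimately have "\<exists>d. proper_on (insert {x, hd ys} F') k d"
      using Cons.IH[of F' c'] c' Cons.prems(3) by blast
    moreover have "insert {x, hd ys} F' = insert {x, y} F"
      using xz Cons by (auto simp: F'_def)
    ultimately show ?thesis by simp
  qed
qed (simp add: fan_def)

lemma fan_spoke:
  assumes "fan F c x ys" "Suc m < length ys"
  shows "{x, ys ! Suc m} \<in> F"
proof -
  have "tl ys ! m \<in> set (tl ys)" using assms(2) by (intro nth_mem) simp
  moreover have "tl ys ! m = ys ! Suc m" using assms(2) by (simp add: nth_tl)
  ultimately show ?thesis using assms(1) by (metis fan_def)
qed

lemma fan_missing: "fan F c x ys \<Longrightarrow> Suc m < length ys \<Longrightarrow> missing F c (ys ! m) (c {x, ys ! Suc m})"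
  by (simp add: fan_def)

lemma fan_distinct: "fan F c x ys \<Longrightarrow> distinct ys"
  by (simp add: fan_def)

text \<open>A swap that avoids \<open>x\<close> does not change any spoke, and a spoke colour other than \<open>\<alpha>\<close> and \<open>\<beta>\<close> stays
  missing wherever it was. Only the spoke of colour \<open>\<beta>\<close>, number \<open>Suc i\<close>, can spoil the fan, and only if
  the swap reaches the leaf \<open>ys ! i\<close> before it.\<close>

lemma fan_after_swap:
  assumes fan: "fan F c x ys" and c: "proper_on F k c" and F: "\<And>e. e \<in> F \<Longrightarrow> card e = 2"
    and \<alpha>: "missing F c x \<alpha>"
    and i: "Suc i < length ys" "c {x, ys ! Suc i} = \<beta>" and j: "j < length ys"
    and x: "x \<notin> kempe F c \<alpha> \<beta> (ys ! j)"
    and ij: "i < j \<Longrightarrow> ys ! i \<notin> kempe F c \<alpha> \<beta> (ys ! j)"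
  shows "fan F (kempe_swap F c \<alpha> \<beta> (ys ! j)) x (take (Suc j) ys)"
  unfolding fan_def
proof (intro conjI ballI allI impI)
  have ys: "ys \<noteq> []" "hd (take (Suc j) ys) = hd ys" using j by auto
  show "take (Suc j) ys \<noteq> []" "distinct (take (Suc j) ys)" "{x, hd (take (Suc j) ys)} \<notin> F"
    "x \<noteq> hd (take (Suc j) ys)"
    using fan ys by (auto simp: fan_def)
  have "tl (take (Suc j) ys) = take j (tl ys)" using ys by (cases ys) auto
  then show "{x, y} \<in> F" if "y \<in> set (tl (take (Suc j) ys))" for y
    using that fan by (auto simp: fan_def dest: in_set_takeD)
  fix l assume "Suc l < length (take (Suc j) ys)"
  then have l: "Suc l < length ys" "l < j" by auto
  define \<delta> where "\<delta> = c {x, ys ! Suc l}"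
  note spoke = fan_spoke[OF fan]
  have "missing F c (ys ! l) \<delta>" using fan_missing[OF fan l(1)] by (simp add: \<delta>_def)
  moreover have "\<delta> \<noteq> \<alpha>" using \<alpha> spoke[OF l(1)] by (auto simp: missing_def \<delta>_def)
  moreover have "ys ! l \<notin> kempe F c \<alpha> \<beta> (ys ! j)" if "\<delta> = \<beta>"
  proof -
    have "ys ! Suc l = ys ! Suc i"
      using proper_on_unique_neighbour[OF c spoke[OF l(1)] spoke[OF i(1)]] that i by (simp add: \<delta>_def)
    then have "l = i" using nth_eq_iff_index_eq[OF fan_distinct[OF fan] l(1) i(1)] by simp
    with ij l show ?thesis by blast
  qed
  ultimately have "missing F (kempe_swap F c \<alpha> \<beta> (ys ! j)) (ys ! l) \<delta>"
    by (subst missing_kempe_swap[OF F]) (auto simp: transpose_def)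
  moreover have "kempe_swap F c \<alpha> \<beta> (ys ! j) {x, ys ! Suc l} = \<delta>"
    using kempe_swap_at[OF spoke[OF l(1)] F[OF spoke[OF l(1)]], of x] x by (simp add: \<delta>_def)
  ultimately show "missing F (kempe_swap F c \<alpha> \<beta> (ys ! j)) (take (Suc j) ys ! l)
      (kempe_swap F c \<alpha> \<beta> (ys ! j) {x, take (Suc j) ys ! Suc l})"
    using l by simp
qed

lemma ex_maximal_fan:
  assumes "finite F" "\<And>e. e \<in> F \<Longrightarrow> card e = 2" "{x, y} \<notin> F" "x \<noteq> y"
  obtains ys where "fan F c x ys" "hd ys = y"
    "\<And>zs. fan F c x zs \<Longrightarrow> hd zs = y \<Longrightarrow> length zs \<le> length ys"
proof -
  let ?P = "\<lambda>ys. fan F c x ys \<and> hd ys = y"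
  have fin: "finite (insert y (\<Union>F))"
    using assms(1,2) card_ge_0_finite by (metis finite_Union finite_insert zero_less_numeral)
  have "length ys \<le> card (insert y (\<Union>F))" if "?P ys" for ys
  proof -
    have "set ys \<subseteq> insert y (\<Union>F)" using that by (cases ys) (auto simp: fan_def)
    then have "card (set ys) \<le> card (insert y (\<Union>F))" using fin by (intro card_mono)
    then show ?thesis using that by (simp add: fan_def distinct_card)
  qed
  moreover have "?P [y]" using assms by (simp add: fan_def)
  ultimately obtain ys where "?P ys" "\<And>zs. ?P zs \<Longrightarrow> length zs \<le> length ys"
    using ex_has_greatest_nat[of ?P "[y]" length "Suc (card (insert y (\<Union>F)))"]
    by (auto simp: less_Suc_eq_le)
  then show ?thesis using that by blast
qed

text \<open>Vizing's argument. Let \<open>\<alpha>\<close> be missing at \<open>x\<close> and \<open>\<beta>\<close> at the last leaf of a maximal fan. If \<open>\<beta>\<close> is not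
  missing at \<open>x\<close>, then by maximality it is the colour of a spoke \<open>ys ! Suc i\<close>, so \<open>\<beta>\<close> is missing at
  \<open>ys ! i\<close> as well. By \<open>kempe_two_ends\<close> one of the leaves \<open>ys ! i\<close> and \<open>last ys\<close> is outside the
  component of \<open>x\<close>. A swap there makes \<open>\<alpha>\<close> missing at this leaf and at \<open>x\<close>, and the fan that ends in
  this leaf can be rotated.\<close>

lemma extend_colouring:
  assumes fin: "finite F" and F: "\<And>e. e \<in> F \<Longrightarrow> card e = 2"
    and deg: "\<And>v. card {e \<in> F. v \<in> e} < k" and c: "proper_on F k c"
    and y: "{x, y} \<notin> F" "x \<noteq> y"
  shows "\<exists>c. proper_on (insert {x, y} F) k c"
proof -
  obtain \<alpha> where \<alpha>: "\<alpha> < k" "missing F c x \<alpha>" using ex_missing[OF fin deg] .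
  obtain ys where ys: "fan F c x ys" "hd ys = y"
    and max: "\<And>zs. fan F c x zs \<Longrightarrow> hd zs = y \<Longrightarrow> length zs \<le> length ys"
    using ex_maximal_fan[OF fin F y] by metis
  obtain \<beta> where \<beta>: "\<beta> < k" "missing F c (last ys) \<beta>" using ex_missing[OF fin deg] .
  show ?thesis
  proof (cases "missing F c x \<beta>")
    case True
    with fan_rotate[OF ys(1) c \<beta>(1) _ \<beta>(2) F] ys(2) show ?thesis by simp
  next
    case False
    then obtain e where e: "e \<in> F" "x \<in> e" "c e = \<beta>" by (auto simp: missing_def)
    with F obtain w where "e = {x, w}" by (metis card_2_iff doubleton_eq_iff insertE singletonD)
    with e have w: "{x, w} \<in> F" "c {x, w} = \<beta>" by auto
    note fan = ys(1)[unfolded fan_def]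
    have "w \<in> set ys"
    proof (rule ccontr)
      assume "w \<notin> set ys"
      have "fan F c x (ys @ [w])"
        unfolding fan_def
      proof (intro conjI ballI allI impI)
        show "missing F c ((ys @ [w]) ! i) (c {x, (ys @ [w]) ! Suc i})"
          if "Suc i < length (ys @ [w])" for i
        proof (cases "Suc i < length ys")
          case False
          with that have "Suc i = length ys" by simp
          then have "i = length ys - 1" by simp
          then have "(ys @ [w]) ! i = last ys" "(ys @ [w]) ! Suc i = w"
            using fan \<open>Suc i = length ys\<close> by (auto simp: nth_append last_conv_nth)
          then show ?thesis using \<beta>(2) w by simp
        qed (use fan in \<open>simp add: nth_append\<close>)
      qed (use fan w \<open>w \<notin> set ys\<close> in auto)
      with max[of "ys @ [w]"] ys fan show False by auto
    qed
    moreover have "w \<noteq> hd ys" using w ys y by auto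
    ultimately obtain i where i: "Suc i < length ys" "ys ! Suc i = w"
      by (metis fan hd_conv_nth in_set_conv_nth not0_implies_Suc)
    have neq: "v \<noteq> x" if "v \<in> set ys" for v
    proof (cases "v = hd ys")
      case False
      with that have "v \<in> set (tl ys)" by (cases ys) auto
      with fan have "{x, v} \<in> F" by blast
      with F[of "{x, v}"] show ?thesis by auto
    qed (use fan in metis)
    \<comment> \<open>Swap at a leaf outside the component of \<open>x\<close> and rotate the part of the fan up to that leaf.\<close>
    have finish: ?thesis
      if j: "j < length ys" "missing F c (ys ! j) \<beta>" and out: "ys ! j \<notin> kempe F c \<alpha> \<beta> x"
        and ij: "i < j \<Longrightarrow> ys ! i \<notin> kempe F c \<alpha> \<beta> (ys ! j)" for j
    proof -
      let ?c = "kempe_swap F c \<alpha> \<beta> (ys ! j)"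
      have x: "x \<notin> kempe F c \<alpha> \<beta> (ys ! j)" using out kempe_sym by metis
      have "fan F ?c x (take (Suc j) ys)"
        using w i by (intro fan_after_swap[OF ys(1) c F \<alpha>(2) i(1) _ j(1) x ij]) auto
      moreover have "proper_on F k ?c" by (rule proper_on_kempe_swap[OF c F \<alpha>(1) \<beta>(1)])
      moreover have "missing F ?c x \<alpha>" using \<alpha>(2) x by (simp add: missing_kempe_swap[OF F])
      moreover have "last (take (Suc j) ys) = ys ! j" using j(1) by (simp add: take_Suc_conv_app_nth)
      moreover have "missing F ?c (ys ! j) \<alpha>"
        using j(2) by (simp add: missing_kempe_swap[OF F] kempe_self)
      moreover have "hd (take (Suc j) ys) = y" using ys(2) by simp
      ultimately show ?thesis using fan_rotate[of F ?c x "take (Suc j) ys" k \<alpha>] \<alpha>(1) F by auto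
    qed
    have a: "missing F c (ys ! i) \<beta>" using fan_missing[OF ys(1) i(1)] i w by simp
    have last: "last ys = ys ! (length ys - 1)" using fan by (simp add: last_conv_nth)
    show ?thesis
    proof (cases "ys ! i \<in> kempe F c \<alpha> \<beta> x")
      case False
      with finish[of i] i a show ?thesis by simp
    next
      case True
      have "ys ! i \<noteq> last ys"
        using nth_eq_iff_index_eq[OF fan_distinct[OF ys(1)], of i "length ys - 1"] i last by auto
      then have "last ys \<notin> kempe F c \<alpha> \<beta> x"
        using kempe_two_ends[OF c \<alpha>(2) a True _ \<beta>(2)] neq i fan by auto
      moreover from this have "ys ! i \<notin> kempe F c \<alpha> \<beta> (last ys)"
        using kempe_trans[OF True] kempe_sym by metis
      ultimately show ?thesis using finish[of "length ys - 1"] \<beta>(2) last i by auto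
    qed
  qed
qed

lemma vizing:
  assumes "finite E" "\<And>e. e \<in> E \<Longrightarrow> card e = 2" "\<And>v. card {e \<in> E. v \<in> e} \<le> D"
  shows "\<exists>c. proper_on E (Suc D) c"
  using assms
proof (induction E rule: finite_induct)
  case (insert e F)
  have deg: "card {f \<in> F. v \<in> f} \<le> D" for v
    using insert.prems(2)[of v] insert.hyps(1)
      card_mono[of "{f \<in> insert e F. v \<in> f}" "{f \<in> F. v \<in> f}"] by fastforce
  obtain c where c: "proper_on F (Suc D) c" using insert.IH insert.prems deg by blast
  obtain x y where "e = {x, y}" "x \<noteq> y" using insert.prems(1)[of e] by (auto simp: card_2_iff)
  with insert extend_colouring[OF insert.hyps(1) _ _ c, of x y] deg
  show ?case by (auto simp: less_Suc_eq_le)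
qed (auto simp: proper_on_def)

section \<open>The Lovasz Local Lemma on finite product spaces\<close>

lemma sum_UN_le:
  fixes f :: "'i \<Rightarrow> real"
  assumes "finite A" "\<And>a. a \<in> A \<Longrightarrow> finite (B a)" "\<And>a i. a \<in> A \<Longrightarrow> i \<in> B a \<Longrightarrow> 0 \<le> f i"
  shows "sum f (\<Union>a\<in>A. B a) \<le> (\<Sum>a\<in>A. sum f (B a))"
proof -
  have "sum f (\<Union>a\<in>A. B a) \<le> (\<Sum>(a, i)\<in>(SIGMA a:A. B a). f i)"
    using assms by (intro sum_le_included[where i = snd]) auto
  also have "\<dots> = (\<Sum>a\<in>A. sum f (B a))" using assms by (subst sum.Sigma) auto
  finally show ?thesis .
qed

text \<open>The local lemma for the uniform distribution on a finite set, with probabilities expressed by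
  cardinalities. By induction on \<open>S\<close>, conditioning on the event that no \<open>A j\<close> with \<open>j \<in> S\<close> happens
  at most doubles the probability of \<open>A i\<close>: the indices outside \<open>\<Gamma> i\<close> have no influence, and given that
  those are avoided, the ones inside \<open>\<Gamma> i\<close> have conditional probabilities of at most \<open>2 * p j\<close>, which sum
  up to at most one half.\<close>

lemma lovasz_local_counting:
  fixes A :: "'i \<Rightarrow> 'w set" and p :: "'i \<Rightarrow> real"
  assumes fin: "finite \<Omega>" "\<Omega> \<noteq> {}" "finite I"
    and sub: "\<And>i. i \<in> I \<Longrightarrow> A i \<subseteq> \<Omega>"
    and bound: "\<And>i. i \<in> I \<Longrightarrow> real (card (A i)) \<le> p i * real (card \<Omega>)"
    and self: "\<And>i. i \<in> I \<Longrightarrow> i \<in> \<Gamma> i"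
    and small: "\<And>i. i \<in> I \<Longrightarrow> (\<Sum>j \<in> I \<inter> \<Gamma> i. p j) \<le> 1/4"
    and indep: "\<And>i J. i \<in> I \<Longrightarrow> J \<subseteq> I - \<Gamma> i \<Longrightarrow>
      card (A i \<inter> (\<Omega> - \<Union>(A ` J))) * card \<Omega> = card (A i) * card (\<Omega> - \<Union>(A ` J))"
  shows "\<Omega> - \<Union>(A ` I) \<noteq> {}"
proof -
  define avoid where "avoid S = \<Omega> - \<Union>(A ` S)" for S
  have \<Omega>_pos: "real (card \<Omega>) > 0" using fin by (simp add: card_gt_0_iff)
  have fin_avoid: "finite (avoid S)" for S using fin by (simp add: avoid_def)
  have p_nonneg: "p i \<ge> 0" if "i \<in> I" for i
  proof -
    have "0 \<le> p i * real (card \<Omega>)" using bound[OF that] by (rule order_trans[rotated]) simp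
    then show ?thesis using \<Omega>_pos by (simp add: zero_le_mult_iff)
  qed
  have cond: "real (card (A i \<inter> avoid S)) \<le> 2 * p i * real (card (avoid S))"
    if "S \<subseteq> I" "i \<in> I" for S i
    using finite_subset[OF that(1) fin(3)] that
  proof (induction S arbitrary: i rule: finite_psubset_induct)
    case (psubset S)
    define far where "far = S - \<Gamma> i"
    define near where "near = S \<inter> \<Gamma> i"
    have "real (card (A i \<inter> avoid far)) * real (card \<Omega>) = real (card (A i)) * real (card (avoid far))"
      using indep[OF psubset.prems(2), of far] psubset.prems(1)
      unfolding far_def avoid_def of_nat_mult[symmetric] by (auto simp del: of_nat_mult)
    also have "\<dots> \<le> (p i * real (card (avoid far))) * real (card \<Omega>)"
      using mult_right_mono[OF bound[OF psubset.prems(2)], of "real (card (avoid far))"]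
      by (simp add: mult_ac)
    finally have far_le: "real (card (A i \<inter> avoid far)) \<le> p i * real (card (avoid far))"
      using \<Omega>_pos by simp
    have "A i \<inter> avoid S \<subseteq> A i \<inter> avoid far"
      by (auto simp: avoid_def far_def)
    then have S_le: "real (card (A i \<inter> avoid S)) \<le> p i * real (card (avoid far))"
      using far_le fin_avoid by (meson card_mono finite_Int of_nat_mono order_trans)
    have half: "real (card (avoid far)) \<le> 2 * real (card (avoid S))"
    proof (cases "near = {}")
      case True
      then have "far = S" by (auto simp: far_def near_def)
      then show ?thesis by simp
    next
      case False
      then have "far \<subset> S" by (auto simp: far_def near_def)
      have near_sub: "near \<subseteq> I" "finite near"
        using psubset by (auto simp: near_def)
      have "avoid far \<subseteq> avoid S \<union> (\<Union>j\<in>near. A j \<inter> avoid far)"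
        by (auto simp: avoid_def far_def near_def)
      then have "card (avoid far) \<le> card (avoid S \<union> (\<Union>j\<in>near. A j \<inter> avoid far))"
        using fin_avoid near_sub by (intro card_mono) auto
      also have "\<dots> \<le> card (avoid S) + card (\<Union>j\<in>near. A j \<inter> avoid far)"
        by (rule card_Un_le)
      also have "\<dots> \<le> card (avoid S) + (\<Sum>j\<in>near. card (A j \<inter> avoid far))"
        using card_UN_le[OF near_sub(2), of "\<lambda>j. A j \<inter> avoid far"] by (intro add_left_mono)
      finally have "real (card (avoid far))
          \<le> real (card (avoid S)) + (\<Sum>j\<in>near. real (card (A j \<inter> avoid far)))"
        by (metis of_nat_add of_nat_le_iff of_nat_sum)
      also have "(\<Sum>j\<in>near. real (card (A j \<inter> avoid far)))
          \<le> (\<Sum>j\<in>near. 2 * p j * real (card (avoid far)))"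
        using psubset.IH[OF \<open>far \<subset> S\<close>] near_sub \<open>far \<subset> S\<close> psubset.prems
        by (intro sum_mono) auto
      also have "\<dots> = 2 * real (card (avoid far)) * (\<Sum>j\<in>near. p j)"
        by (simp add: sum_distrib_right mult_ac)
      also have "(\<Sum>j\<in>near. p j) \<le> (\<Sum>j\<in>I \<inter> \<Gamma> i. p j)"
        using fin psubset.prems p_nonneg by (intro sum_mono2) (auto simp: near_def)
      also have "\<dots> \<le> 1/4" by (rule small[OF psubset.prems(2)])
      finally show ?thesis by (simp add: mult_left_mono)
    qed
    show ?case
      using S_le mult_left_mono[OF half p_nonneg[OF psubset.prems(2)]] by simp
  qed
  have "avoid S \<noteq> {}" if "S \<subseteq> I" for S
    using finite_subset[OF that fin(3)] that
  proof (induction S rule: finite_induct)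
    case (insert i S)
    have "p i \<le> (\<Sum>j\<in>I \<inter> \<Gamma> i. p j)"
      using insert.prems self p_nonneg fin by (intro member_le_sum) auto
    with small[of i] insert.prems have "p i \<le> 1/4" by auto
    then have "2 * p i * real (card (avoid S)) \<le> 1/2 * real (card (avoid S))"
      by (intro mult_right_mono) auto
    moreover have "real (card (avoid S)) > 0"
      using insert fin_avoid by (auto simp: card_gt_0_iff)
    moreover have "real (card (A i \<inter> avoid S)) \<le> 2 * p i * real (card (avoid S))"
      using cond[of S i] insert.prems by blast
    ultimately have "card (A i \<inter> avoid S) < card (avoid S)" by linarith
    moreover have "avoid S \<subseteq> A i" if "avoid (insert i S) = {}"
      using that by (auto simp: avoid_def)
    ultimately show ?case by (metis inf.absorb2 less_irrefl)
  qed (use fin in \<open>simp add: avoid_def\<close>)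
  then show ?thesis by (simp add: avoid_def)
qed

definition determined_by :: "'e set \<Rightarrow> ('e \<Rightarrow> 'c) set \<Rightarrow> ('e \<Rightarrow> 'c) set \<Rightarrow> bool" where
  "determined_by D \<Omega> A \<longleftrightarrow>
     A \<subseteq> \<Omega> \<and> (\<forall>f\<in>A. \<forall>g\<in>\<Omega>. (\<forall>x\<in>D. g x = f x) \<longrightarrow> g \<in> A)"

lemma determined_byD:
  "determined_by D \<Omega> A \<Longrightarrow> f \<in> A \<Longrightarrow> g \<in> \<Omega> \<Longrightarrow> (\<And>x. x \<in> D \<Longrightarrow> g x = f x) \<Longrightarrow> g \<in> A"
  by (auto simp: determined_by_def)

text \<open>Exchanging the coordinates in \<open>D\<close> between two points is a bijection from \<open>A \<times> B\<close> to
  \<open>(A \<inter> B) \<times> \<Omega>\<close>.\<close>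

lemma determined_by_independent:
  fixes E :: "'e set" and C :: "'c set"
  defines "\<Omega> \<equiv> E \<rightarrow>\<^sub>E C"
  assumes fin: "finite E" "finite C"
    and A: "determined_by D \<Omega> A" and B: "determined_by (E - D) \<Omega> B"
  shows "card (A \<inter> B) * card \<Omega> = card A * card B"
proof -
  define swap where "swap = (\<lambda>(f::'e \<Rightarrow> 'c, g). (override_on g f D, override_on f g D))"
  have in_\<Omega>: "override_on f g D \<in> \<Omega>" if "f \<in> \<Omega>" "g \<in> \<Omega>" for f g
    using that unfolding \<Omega>_def override_on_def PiE_def Pi_def extensional_def by auto
  have "bij_betw swap (A \<times> B) ((A \<inter> B) \<times> \<Omega>)"
  proof (rule bij_betw_byWitness[where f' = swap])
    show "\<forall>a\<in>A \<times> B. swap (swap a) = a" "\<forall>a\<in>(A \<inter> B) \<times> \<Omega>. swap (swap a) = a"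
      by (auto simp: swap_def override_on_def fun_eq_iff)
    show "swap ` (A \<times> B) \<subseteq> (A \<inter> B) \<times> \<Omega>"
    proof (clarsimp simp: swap_def)
      fix f g assume fg: "f \<in> A" "g \<in> B"
      then have \<Omega>: "f \<in> \<Omega>" "g \<in> \<Omega>" using A B by (auto simp: determined_by_def)
      show "override_on g f D \<in> A \<and> override_on g f D \<in> B \<and> override_on f g D \<in> \<Omega>"
      proof (intro conjI)
        show "override_on g f D \<in> A"
          using determined_byD[OF A fg(1) in_\<Omega>[OF \<Omega>(2,1)]] by (simp add: override_on_def)
        show "override_on g f D \<in> B"
          using determined_byD[OF B fg(2) in_\<Omega>[OF \<Omega>(2,1)]] by (simp add: override_on_def)
      qed (rule in_\<Omega>[OF \<Omega>])
    qed
    show "swap ` ((A \<inter> B) \<times> \<Omega>) \<subseteq> A \<times> B"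
    proof (clarsimp simp: swap_def)
      fix f g assume fg: "f \<in> A" "f \<in> B" "g \<in> \<Omega>"
      then have "f \<in> \<Omega>" using A by (auto simp: determined_by_def)
      with fg(3) have \<Omega>: "override_on g f D \<in> \<Omega>" "override_on f g D \<in> \<Omega>"
        by (auto intro: in_\<Omega>)
      show "override_on g f D \<in> A \<and> override_on f g D \<in> B"
        using determined_byD[OF A fg(1) \<Omega>(1)] determined_byD[OF B fg(2) \<Omega>(2)]
        by (simp add: override_on_def)
    qed
  qed
  then have "card (A \<times> B) = card ((A \<inter> B) \<times> \<Omega>)" by (rule bij_betw_same_card)
  then show ?thesis by (simp add: card_cartesian_product)
qed

text \<open>Two events can only influence each other through a shared coordinate. So it suffices to bound the total
  probability \<open>s\<close> of the events that see a given coordinate, and the number \<open>L\<close> of coordinates of an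
  event.\<close>

lemma lovasz_local_product:
  fixes E :: "'e set" and C :: "'c set" and A :: "'i \<Rightarrow> ('e \<Rightarrow> 'c) set"
    and p :: "'i \<Rightarrow> real" and s :: real and L :: nat
  defines "\<Omega> \<equiv> E \<rightarrow>\<^sub>E C"
  assumes fin: "finite E" "finite C" "C \<noteq> {}" "finite I"
    and D: "\<And>i. i \<in> I \<Longrightarrow> D i \<subseteq> E" "\<And>i. i \<in> I \<Longrightarrow> D i \<noteq> {}" "\<And>i. i \<in> I \<Longrightarrow> card (D i) \<le> L"
    and det: "\<And>i. i \<in> I \<Longrightarrow> determined_by (D i) \<Omega> (A i)"
    and bound: "\<And>i. i \<in> I \<Longrightarrow> real (card (A i)) \<le> p i * real (card \<Omega>)"
    and nonneg: "\<And>i. i \<in> I \<Longrightarrow> 0 \<le> p i"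
    and load: "\<And>e. e \<in> E \<Longrightarrow> (\<Sum>i | i \<in> I \<and> e \<in> D i. p i) \<le> s"
    and small: "real L * s \<le> 1/4" and "0 \<le> s"
  shows "\<exists>f\<in>\<Omega>. \<forall>i\<in>I. f \<notin> A i"
proof -
  define \<Gamma> where "\<Gamma> i = {j. D j \<inter> D i \<noteq> {}}" for i
  have "\<Omega> - \<Union>(A ` I) \<noteq> {}"
  proof (rule lovasz_local_counting[where p = p and \<Gamma> = \<Gamma>])
    show "finite \<Omega>" "\<Omega> \<noteq> {}" using fin by (auto simp: \<Omega>_def PiE_eq_empty_iff intro: finite_PiE)
    show "A i \<subseteq> \<Omega>" if "i \<in> I" for i using det[OF that] by (simp add: determined_by_def)
    show "i \<in> \<Gamma> i" if "i \<in> I" for i using D(2)[OF that] by (auto simp: \<Gamma>_def)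
    show "(\<Sum>j\<in>I \<inter> \<Gamma> i. p j) \<le> 1/4" if i: "i \<in> I" for i
    proof -
      have "I \<inter> \<Gamma> i = (\<Union>e\<in>D i. {j \<in> I. e \<in> D j})" by (auto simp: \<Gamma>_def)
      moreover have "finite (D i)" using D(1)[OF i] fin(1) by (rule finite_subset)
      ultimately have "(\<Sum>j\<in>I \<inter> \<Gamma> i. p j) \<le> (\<Sum>e\<in>D i. \<Sum>j | j \<in> I \<and> e \<in> D j. p j)"
        using fin nonneg by (simp only:) (rule sum_UN_le, auto)
      also have "\<dots> \<le> (\<Sum>e\<in>D i. s)" using D(1)[OF i] load by (intro sum_mono) auto
      also have "\<dots> \<le> real L * s" using D(3)[OF i] \<open>0 \<le> s\<close> by (simp add: mult_right_mono)
      finally show ?thesis using small by simp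
    qed
    fix i J assume iJ: "i \<in> I" "J \<subseteq> I - \<Gamma> i"
    have "determined_by (E - D i) \<Omega> (\<Omega> - \<Union>(A ` J))"
      unfolding determined_by_def
    proof (intro conjI ballI impI)
      fix f g assume f: "f \<in> \<Omega> - \<Union>(A ` J)" and g: "g \<in> \<Omega>" and agree: "\<forall>x\<in>E - D i. g x = f x"
      have "g \<notin> A j" if j: "j \<in> J" for j
      proof
        assume "g \<in> A j"
        moreover have "\<forall>x\<in>D j. f x = g x"
        proof
          fix x assume "x \<in> D j"
          moreover have "j \<in> I" "D j \<inter> D i = {}" using j iJ by (auto simp: \<Gamma>_def)
          ultimately have "x \<in> E - D i" using D(1)[of j] by blast
          with agree show "f x = g x" by simp
        qed
        ultimately have "f \<in> A j" using det[of j] j iJ f unfolding determined_by_def by blast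
        with f j show False by blast
      qed
      with g show "g \<in> \<Omega> - \<Union>(A ` J)" by blast
    qed auto
    with det[OF iJ(1)] show "card (A i \<inter> (\<Omega> - \<Union>(A ` J))) * card \<Omega>
        = card (A i) * card (\<Omega> - \<Union>(A ` J))"
      unfolding \<Omega>_def by (intro determined_by_independent[OF fin(1,2), where D="D i"])
  qed (use fin bound in auto)
  then show ?thesis by blast
qed

section \<open>Random functions on a finite set\<close>

text \<open>Two functions on \<open>X\<close> that take the same values equally often differ by a permutation of \<open>X\<close>.\<close>

lemma card_functions_with_image_mset_le:
  fixes M :: "'c multiset"
  assumes "finite X"
  shows "card {h \<in> X \<rightarrow>\<^sub>E C. image_mset h (mset_set X) = M} \<le> fact (card X)"
proof (cases "{h \<in> X \<rightarrow>\<^sub>E C. image_mset h (mset_set X) = M} = {}")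
  case False
  then obtain g where g: "g \<in> X \<rightarrow>\<^sub>E C" "image_mset g (mset_set X) = M" by blast
  have "{h \<in> X \<rightarrow>\<^sub>E C. image_mset h (mset_set X) = M} \<subseteq> (\<lambda>\<pi>. restrict (g \<circ> \<pi>) X) ` {\<pi>. \<pi> permutes X}"
  proof
    fix h assume h: "h \<in> {h \<in> X \<rightarrow>\<^sub>E C. image_mset h (mset_set X) = M}"
    then have "image_mset h (mset_set X) = image_mset g (mset_set X)" using g by simp
    with \<open>finite X\<close> obtain \<pi> where \<pi>: "\<pi> permutes X" "\<forall>x\<in>X. h x = g (\<pi> x)"
      by (rule image_mset_eq_implies_permutes)
    have "h = restrict (g \<circ> \<pi>) X"
      using h \<pi>(2) by (auto simp: fun_eq_iff restrict_def PiE_def extensional_def)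
    with \<pi>(1) show "h \<in> (\<lambda>\<pi>. restrict (g \<circ> \<pi>) X) ` {\<pi>. \<pi> permutes X}" by blast
  qed
  from surj_card_le[OF finite_permutations[OF \<open>finite X\<close>] this]
  show ?thesis by (simp add: card_permutations[OF refl \<open>finite X\<close>])
qed (simp only: card.empty)

text \<open>Conditioning on the values outside \<open>X\<close>, in terms of cardinalities.\<close>

lemma card_le_of_sections:
  fixes A :: "('e \<Rightarrow> 'c) set"
  assumes fin: "finite E" "finite C" and X: "X \<subseteq> E" and A: "A \<subseteq> E \<rightarrow>\<^sub>E C"
    and fibre: "\<And>g. g \<in> (E - X) \<rightarrow>\<^sub>E C \<Longrightarrow>
      card {h \<in> X \<rightarrow>\<^sub>E C. (\<lambda>e. if e \<in> X then h e else g e) \<in> A} \<le> b"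
  shows "card A \<le> b * card C ^ (card E - card X)"
proof -
  define H where "H g = {h \<in> X \<rightarrow>\<^sub>E C. (\<lambda>e. if e \<in> X then h e else g e) \<in> A}" for g
  define merge where "merge = (\<lambda>(g::'e \<Rightarrow> 'c, h) e. if e \<in> X then h e else g e)"
  have finX: "finite X" "finite (E - X)" using fin X by (auto intro: finite_subset[OF X])
  have "A \<subseteq> merge ` (SIGMA g:(E - X) \<rightarrow>\<^sub>E C. H g)"
  proof
    fix f assume "f \<in> A"
    then have f: "f \<in> E \<rightarrow>\<^sub>E C" using A by blast
    have merge: "(\<lambda>e. if e \<in> X then restrict f X e else restrict f (E - X) e) = f"
      using f by (auto simp: fun_eq_iff restrict_def PiE_def extensional_def)
    have "restrict f (E - X) \<in> (E - X) \<rightarrow>\<^sub>E C" "restrict f X \<in> X \<rightarrow>\<^sub>E C" using f X by auto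
    then have "(restrict f (E - X), restrict f X) \<in> (SIGMA g:(E - X) \<rightarrow>\<^sub>E C. H g)"
      using merge \<open>f \<in> A\<close> by (simp add: H_def)
    moreover have "f = merge (restrict f (E - X), restrict f X)"
      using merge unfolding merge_def by (simp only: prod.case)
    ultimately show "f \<in> merge ` (SIGMA g:(E - X) \<rightarrow>\<^sub>E C. H g)" by (rule rev_image_eqI)
  qed
  moreover have fin': "finite ((E - X) \<rightarrow>\<^sub>E C)" "finite (H g)" for g
    using finX fin by (simp_all add: H_def finite_PiE)
  ultimately have "card A \<le> card (SIGMA g:(E - X) \<rightarrow>\<^sub>E C. H g)"
    by (intro surj_card_le finite_SigmaI)
  also have "\<dots> = (\<Sum>g\<in>(E - X) \<rightarrow>\<^sub>E C. card (H g))" using fin' by (intro card_SigmaI) auto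
  also have "\<dots> \<le> (\<Sum>g\<in>(E - X) \<rightarrow>\<^sub>E C. b)" using fibre by (intro sum_mono) (simp add: H_def)
  also have "\<dots> = b * card C ^ (card E - card X)"
    using finX X fin by (simp add: card_PiE card_Diff_subset)
  finally show ?thesis .
qed

text \<open>Once \<open>f\<close> is known outside \<open>X\<close>, the multisets can agree only if the values on \<open>X\<close> form one particular
  multiset, which leaves at most \<open>fact (card X)\<close> possibilities. The bound does not get worse when \<open>S\<close> and
  \<open>T\<close> are much larger than \<open>X\<close>; this is what makes vertices of all degrees behave alike below.\<close>

lemma card_equal_image_mset_le:
  fixes E :: "'e set" and C :: "'c set"
  assumes fin: "finite E" "finite C" and "S \<subseteq> E" "T \<subseteq> E" and X: "X \<subseteq> S - T"
  shows "card {f \<in> E \<rightarrow>\<^sub>E C. image_mset f (mset_set S) = image_mset f (mset_set T)}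
    \<le> fact (card X) * card C ^ (card E - card X)"
proof (rule card_le_of_sections[OF fin])
  show "X \<subseteq> E" using assms by blast
  fix g assume "g \<in> (E - X) \<rightarrow>\<^sub>E C"
  let ?m = "\<lambda>h e. if e \<in> X then h e else g e"
  define M where "M = image_mset g (mset_set T) - image_mset g (mset_set (S - X))"
  have "finite S" "finite T" using assms(3,4) by (auto intro: finite_subset[OF _ fin(1)])
  moreover have "finite X" using X by (intro finite_subset[OF _ \<open>finite S\<close>]) auto
  ultimately have finS: "finite S" "finite T" "finite X" by auto
  have "image_mset h (mset_set X) = M"
    if eq: "image_mset (?m h) (mset_set S) = image_mset (?m h) (mset_set T)" for h :: "'e \<Rightarrow> 'c"
  proof -
    have "mset_set S = mset_set X + mset_set (S - X)"
    proof -
      have "X \<union> (S - X) = S" "X \<inter> (S - X) = {}" using X by auto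
      with finS mset_set_Union[of X "S - X"] show ?thesis by simp
    qed
    moreover have "image_mset (?m h) (mset_set X) = image_mset h (mset_set X)"
      using finS by (intro image_mset_cong) simp
    moreover have "image_mset (?m h) (mset_set (S - X)) = image_mset g (mset_set (S - X))"
      using finS by (intro image_mset_cong) simp
    moreover have "image_mset (?m h) (mset_set T) = image_mset g (mset_set T)"
      using finS X by (intro image_mset_cong) auto
    ultimately have "image_mset h (mset_set X) + image_mset g (mset_set (S - X)) = image_mset g (mset_set T)"
      using eq by simp
    then show ?thesis unfolding M_def by (metis add_diff_cancel_right')
  qed
  then have "{h \<in> X \<rightarrow>\<^sub>E C. ?m h \<in> {f \<in> E \<rightarrow>\<^sub>E C. image_mset f (mset_set S) = image_mset f (mset_set T)}}
      \<subseteq> {h \<in> X \<rightarrow>\<^sub>E C. image_mset h (mset_set X) = M}"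
    by (intro subsetI CollectI conjI) (simp_all only: mem_Collect_eq)
  moreover have "finite {h \<in> X \<rightarrow>\<^sub>E C. image_mset h (mset_set X) = M}"
    using finS(3) fin(2) by (simp add: finite_PiE)
  ultimately have "card {h \<in> X \<rightarrow>\<^sub>E C.
        ?m h \<in> {f \<in> E \<rightarrow>\<^sub>E C. image_mset f (mset_set S) = image_mset f (mset_set T)}}
      \<le> card {h \<in> X \<rightarrow>\<^sub>E C. image_mset h (mset_set X) = M}"
    by (intro card_mono)
  also have "\<dots> \<le> fact (card X)" by (rule card_functions_with_image_mset_le[OF finS(3)])
  finally show "card {h \<in> X \<rightarrow>\<^sub>E C.
        ?m h \<in> {f \<in> E \<rightarrow>\<^sub>E C. image_mset f (mset_set S) = image_mset f (mset_set T)}}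
      \<le> fact (card X)" .
qed auto

text \<open>The generating function of the number of elements of \<open>S\<close> that a random function sends to \<open>i\<close>. Each
  coordinate contributes one factor.\<close>

lemma sum_power_class_size:
  fixes t :: real
  assumes fin: "finite E" "finite C" and "S \<subseteq> E" and "i \<in> C"
  shows "(\<Sum>f\<in>E \<rightarrow>\<^sub>E C. t ^ card {e \<in> S. f e = i})
    = (real (card C) - 1 + t) ^ card S * real (card C) ^ (card E - card S)"
proof -
  have finS: "finite S" by (rule finite_subset[OF \<open>S \<subseteq> E\<close> fin(1)])
  let ?w = "\<lambda>e c. if e \<in> S \<and> c = i then t else 1"
  have "t ^ card {e \<in> S. f e = i} = (\<Prod>e\<in>E. ?w e (f e))" for f
  proof -
    have "(\<Prod>e\<in>E. ?w e (f e)) = (\<Prod>e\<in>{e \<in> S. f e = i}. t)"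
      using fin \<open>S \<subseteq> E\<close> by (intro prod.mono_neutral_cong_right) auto
    then show ?thesis by simp
  qed
  then have "(\<Sum>f\<in>E \<rightarrow>\<^sub>E C. t ^ card {e \<in> S. f e = i}) = (\<Sum>f\<in>E \<rightarrow>\<^sub>E C. \<Prod>e\<in>E. ?w e (f e))"
    by simp
  also have "\<dots> = (\<Prod>e\<in>E. \<Sum>c\<in>C. ?w e c)"
    using fin by (simp add: prod_sum_PiE)
  also have "\<dots> = (\<Prod>e\<in>E. if e \<in> S then real (card C) - 1 + t else real (card C))"
  proof (rule prod.cong[OF refl])
    fix e
    have "(\<Sum>c\<in>C. ?w e c) = (\<Sum>c\<in>C. 1 + (if c = i then (if e \<in> S then t - 1 else 0) else 0))"
      by (intro sum.cong) auto
    also have "\<dots> = (if e \<in> S then real (card C) - 1 + t else real (card C))"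
      using fin \<open>i \<in> C\<close> by (subst sum.distrib) simp
    finally show "(\<Sum>c\<in>C. ?w e c) = (if e \<in> S then real (card C) - 1 + t else real (card C))" .
  qed
  also have "\<dots> = (real (card C) - 1 + t) ^ card S * real (card C) ^ (card E - card S)"
    using fin \<open>S \<subseteq> E\<close> finS
    by (simp add: prod.If_cases Int_absorb1 card_Diff_subset Diff_eq[symmetric])
  finally show ?thesis .
qed

text \<open>The Chernoff bound for the upper tail of a binomial variable with mean at most \<open>\<mu>\<close>: Markov's
  inequality for the generating function at \<open>1 + \<epsilon>\<close>.\<close>

lemma card_overfull_class_le:
  fixes \<epsilon> \<mu> :: real
  assumes fin: "finite E" "finite C" and "S \<subseteq> E" and "i \<in> C" and "\<epsilon> > 0"
    and \<mu>: "real (card S) \<le> \<mu> * real (card C)"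
  shows "real (card {f \<in> E \<rightarrow>\<^sub>E C. (1 + \<epsilon>) * \<mu> < real (card {e \<in> S. f e = i})})
    \<le> exp (- ((1 + \<epsilon>) * ln (1 + \<epsilon>) - \<epsilon>) * \<mu>) * real (card (E \<rightarrow>\<^sub>E C))"
proof -
  define bad where "bad = {f \<in> E \<rightarrow>\<^sub>E C. (1 + \<epsilon>) * \<mu> < real (card {e \<in> S. f e = i})}"
  let ?n = "real (card C)" and ?a = "(1 + \<epsilon>) * \<mu>"
  have finS: "finite S" by (rule finite_subset[OF \<open>S \<subseteq> E\<close> fin(1)])
  have fin\<Omega>: "finite (E \<rightarrow>\<^sub>E C)" using fin by (simp add: finite_PiE)
  have n: "?n \<ge> 1" using fin \<open>i \<in> C\<close> by (metis One_nat_def Suc_leI card_gt_0_iff empty_iff of_nat_1 of_nat_le_iff)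
  have "(1 + \<epsilon>) powr ?a * real (card bad) = (\<Sum>f\<in>bad. (1 + \<epsilon>) powr ?a)" by simp
  also have "\<dots> \<le> (\<Sum>f\<in>bad. (1 + \<epsilon>) ^ card {e \<in> S. f e = i})"
  proof (rule sum_mono)
    fix f assume "f \<in> bad"
    then have "(1 + \<epsilon>) powr ?a \<le> (1 + \<epsilon>) powr real (card {e \<in> S. f e = i})"
      using \<open>\<epsilon> > 0\<close> by (intro powr_mono) (auto simp: bad_def)
    then show "(1 + \<epsilon>) powr ?a \<le> (1 + \<epsilon>) ^ card {e \<in> S. f e = i}"
      using \<open>\<epsilon> > 0\<close> by (simp add: powr_realpow)
  qed
  also have "\<dots> \<le> (\<Sum>f\<in>E \<rightarrow>\<^sub>E C. (1 + \<epsilon>) ^ card {e \<in> S. f e = i})"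
    using fin\<Omega> \<open>\<epsilon> > 0\<close> by (intro sum_mono2) (auto simp: bad_def)
  also have "\<dots> = (?n + \<epsilon>) ^ card S * ?n ^ (card E - card S)"
    using sum_power_class_size[OF fin \<open>S \<subseteq> E\<close> \<open>i \<in> C\<close>, of "1 + \<epsilon>"] by simp
  also have "\<dots> = (1 + \<epsilon> / ?n) ^ card S * ?n ^ card E"
  proof -
    have "?n + \<epsilon> = (1 + \<epsilon> / ?n) * ?n" using n by (simp add: field_simps)
    moreover have "?n ^ card E = ?n ^ card S * ?n ^ (card E - card S)"
      using card_mono[OF fin(1) \<open>S \<subseteq> E\<close>] by (simp flip: power_add)
    ultimately show ?thesis by (simp add: power_mult_distrib)
  qed
  also have "\<dots> \<le> exp (\<epsilon> * \<mu>) * ?n ^ card E"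
  proof (rule mult_right_mono)
    have "(1 + \<epsilon> / ?n) ^ card S \<le> exp (\<epsilon> / ?n) ^ card S"
      using \<open>\<epsilon> > 0\<close> n by (intro power_mono exp_ge_add_one_self) auto
    also have "\<dots> = exp (\<epsilon> * (real (card S) / ?n))" by (simp flip: exp_of_nat_mult)
    also have "\<dots> \<le> exp (\<epsilon> * \<mu>)" using \<mu> n \<open>\<epsilon> > 0\<close> by (simp add: field_simps)
    finally show "(1 + \<epsilon> / ?n) ^ card S \<le> exp (\<epsilon> * \<mu>)" .
  qed simp
  finally have *: "(1 + \<epsilon>) powr ?a * real (card bad) \<le> exp (\<epsilon> * \<mu>) * ?n ^ card E" .
  have "real (card bad) = (1 + \<epsilon>) powr (- ?a) * ((1 + \<epsilon>) powr ?a * real (card bad))"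
  proof -
    have "(1 + \<epsilon>) powr (- ?a) * (1 + \<epsilon>) powr ?a = 1"
      using \<open>\<epsilon> > 0\<close> by (simp flip: powr_add)
    then show ?thesis by (simp only: mult.assoc[symmetric] mult_1_left)
  qed
  also have "\<dots> \<le> (1 + \<epsilon>) powr (- ?a) * (exp (\<epsilon> * \<mu>) * ?n ^ card E)"
    using * by (intro mult_left_mono) auto
  also have "\<dots> = exp (- ((1 + \<epsilon>) * ln (1 + \<epsilon>) - \<epsilon>) * \<mu>) * ?n ^ card E"
    using \<open>\<epsilon> > 0\<close> by (simp add: powr_def algebra_simps flip: exp_add)
  finally show ?thesis using fin by (simp add: bad_def card_PiE)
qed

section \<open>Random splittings of the edge set\<close>

definition edges_at :: "'v set set \<Rightarrow> 'v \<Rightarrow> 'v set set" where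
  "edges_at E v = {e \<in> E. v \<in> e}"

lemma card_neighbours_eq_card_edges_at:
  assumes "\<And>e. e \<in> E \<Longrightarrow> card e = 2"
  shows "card {u. {u, v} \<in> E} = card (edges_at E v)"
proof -
  have "edges_at E v = (\<lambda>u. {u, v}) ` {u. {u, v} \<in> E}"
  proof (intro equalityI subsetI)
    fix e assume e: "e \<in> edges_at E v"
    with assms[of e] obtain a b where "e = {a, b}" by (auto simp: card_2_iff edges_at_def)
    with e show "e \<in> (\<lambda>u. {u, v}) ` {u. {u, v} \<in> E}"
      by (cases "v = a") (auto simp: edges_at_def insert_commute)
  qed (auto simp: edges_at_def)
  moreover have "inj_on (\<lambda>u. {u, v}) {u. {u, v} \<in> E}"
    by (auto simp: inj_on_def doubleton_eq_iff)
  ultimately show ?thesis by (simp add: card_image)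
qed

lemma edges_at_Int:
  assumes "\<And>e. e \<in> E \<Longrightarrow> card e = 2" and "u \<noteq> v"
  shows "edges_at E u \<inter> edges_at E v = E \<inter> {{u, v}}"
proof -
  have "e = {u, v}" if "e \<in> E" "u \<in> e" "v \<in> e" for e
    using assms(1)[OF that(1)] that(2,3) \<open>u \<noteq> v\<close> by (auto simp: card_2_iff)
  then show ?thesis by (auto simp: edges_at_def)
qed

text \<open>The edge \<open>{u, v}\<close>, if present, contributes the same value to both sides. Every other edge at \<open>u\<close> is
  not an edge at \<open>v\<close>, so any \<open>k\<close> of them can serve as the set \<open>X\<close> in \<open>card_equal_image_mset_le\<close>.\<close>

lemma card_clash_le:
  fixes E :: "'v set set" and C :: "'c set"
  assumes fin: "finite E" "finite C" "C \<noteq> {}" and E: "\<And>e. e \<in> E \<Longrightarrow> card e = 2"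
    and "u \<noteq> v" and k: "k + card (E \<inter> {{u, v}}) \<le> card (edges_at E u)"
  shows "real (card {f \<in> E \<rightarrow>\<^sub>E C.
        image_mset f (mset_set (edges_at E u)) = image_mset f (mset_set (edges_at E v))})
    \<le> fact k / real (card C) ^ k * real (card (E \<rightarrow>\<^sub>E C))"
proof -
  have sub: "edges_at E w \<subseteq> E" for w by (auto simp: edges_at_def)
  have finE: "finite (edges_at E u)" by (rule finite_subset[OF sub fin(1)])
  have "card (edges_at E u) - card (E \<inter> {{u, v}}) = card (edges_at E u - edges_at E v)"
    using card_Diff_subset_Int[of "edges_at E u" "edges_at E v"] finE edges_at_Int[OF E \<open>u \<noteq> v\<close>]
    by simp
  then have "k \<le> card (edges_at E u - edges_at E v)" using k by simp
  then obtain X where X: "X \<subseteq> edges_at E u - edges_at E v" "card X = k"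
    by (meson obtain_subset_with_card_n)
  have "k \<le> card E"
    using card_mono[OF fin(1), of X] X sub by auto
  then have "real (card C) ^ card E = real (card C) ^ k * real (card C) ^ (card E - k)"
    by (simp flip: power_add)
  moreover have "real (card C) > 0" using fin by (simp add: card_gt_0_iff)
  moreover have "real (card {f \<in> E \<rightarrow>\<^sub>E C.
        image_mset f (mset_set (edges_at E u)) = image_mset f (mset_set (edges_at E v))})
      \<le> real (fact k * card C ^ (card E - k))"
    using card_equal_image_mset_le[OF fin(1,2) sub sub X(1)] X(2) by (subst of_nat_le_iff) simp
  ultimately show ?thesis using fin by (simp add: card_PiE)
qed

lemma sum_Un_le:
  fixes f :: "'i \<Rightarrow> real"
  assumes "finite A" "finite B" "\<And>i. i \<in> A \<union> B \<Longrightarrow> 0 \<le> f i"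
  shows "sum f (A \<union> B) \<le> sum f A + sum f B"
proof -
  have "0 \<le> sum f (A \<inter> B)" using assms(3) by (intro sum_nonneg) auto
  with sum.union_inter[OF assms(1,2), of f] show ?thesis by linarith
qed

text \<open>An index type for the events to which the local lemma is applied. The sample space consists of all
  assignments of the edges to \<open>m\<close> classes, so the coordinates of an event are the edges in its scope.\<close>

datatype 'v event = Overfull 'v nat | Clash 'v 'v

primrec scope :: "'v set set \<Rightarrow> 'v event \<Rightarrow> 'v set set" where
  "scope E (Overfull v i) = edges_at E v"
| "scope E (Clash u v) = edges_at E u \<union> edges_at E v"

primrec bad_splits :: "'v set set \<Rightarrow> nat \<Rightarrow> real \<Rightarrow> 'v event \<Rightarrow> ('v set \<Rightarrow> nat) set" where
  "bad_splits E m b (Overfull v i) = {f \<in> E \<rightarrow>\<^sub>E {..<m}. b < real (card {e \<in> edges_at E v. f e = i})}"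
| "bad_splits E m b (Clash u v) = {f \<in> E \<rightarrow>\<^sub>E {..<m}.
     image_mset f (mset_set (edges_at E u)) = image_mset f (mset_set (edges_at E v))}"

lemma determined_by_bad_splits:
  assumes "finite E"
  shows "determined_by (scope E j) (E \<rightarrow>\<^sub>E {..<m}) (bad_splits E m b j)"
proof (cases j)
  case (Overfull v i)
  have same_class: "{e \<in> edges_at E v. g e = i} = {e \<in> edges_at E v. f e = i}"
    if "\<forall>e\<in>edges_at E v. g e = f e" for f g :: "'a set \<Rightarrow> nat"
    using that by auto
  show ?thesis unfolding determined_by_def
  proof (intro conjI ballI impI)
    fix f g assume "f \<in> bad_splits E m b j" "g \<in> E \<rightarrow>\<^sub>E {..<m}" "\<forall>e\<in>scope E j. g e = f e"
    with same_class[of g f] show "g \<in> bad_splits E m b j" by (simp add: Overfull)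
  qed (auto simp: Overfull)
next
  case (Clash u v)
  have fin: "finite (edges_at E w)" for w using assms by (simp add: edges_at_def)
  have same_image: "image_mset g (mset_set (edges_at E w)) = image_mset f (mset_set (edges_at E w))"
    if "\<forall>e\<in>scope E j. g e = f e" "w \<in> {u, v}" for f g :: "'a set \<Rightarrow> nat" and w
    using that fin Clash by (intro image_mset_cong) auto
  show ?thesis unfolding determined_by_def
  proof (intro conjI ballI impI)
    fix f g assume "f \<in> bad_splits E m b j" "g \<in> E \<rightarrow>\<^sub>E {..<m}" "\<forall>e\<in>scope E j. g e = f e"
    with same_image[of g f] show "g \<in> bad_splits E m b j" by (simp add: Clash)
  qed (auto simp: Clash)
qed

text \<open>The local lemma for these events. The set \<open>Q\<close> consists of the pairs of vertices to be distinguished. The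
  bound \<open>q\<close> is the Chernoff bound for an overfull class, and \<open>P j\<close> bounds the probability of a clash when
  at least \<open>j\<close> edges at \<open>u\<close> are not shared with \<open>v\<close>: one edge fewer is available for adjacent vertices, but a
  vertex has only \<open>D\<close> neighbours, while it may have \<open>N\<close> partners in \<open>Q\<close>.\<close>

lemma ex_distinguishing_split:
  fixes E :: "'v set set" and V :: "'v set" and Q :: "('v \<times> 'v) set" and \<epsilon> \<mu> :: real
    and k m D N :: nat
  defines "q \<equiv> exp (- ((1 + \<epsilon>) * ln (1 + \<epsilon>) - \<epsilon>) * \<mu>)"
  defines "P \<equiv> (\<lambda>j. fact j / real m ^ j)"
  assumes "finite V" and E: "\<And>e. e \<in> E \<Longrightarrow> e \<subseteq> V \<and> card e = 2"
    and deg: "\<And>v. v \<in> V \<Longrightarrow> Suc k \<le> card (edges_at E v)" "\<And>v. v \<in> V \<Longrightarrow> card (edges_at E v) \<le> D"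
    and Q: "Q \<subseteq> V \<times> V" "sym Q" "irrefl Q" "\<And>v. card (Q `` {v}) \<le> N"
    and "m > 0" "\<epsilon> > 0" and \<mu>: "real D \<le> \<mu> * real m"
    and small: "real (2 * D) * (2 * (real m * q + 2 * (real N * P (Suc k) + real D * P k))) \<le> 1/4"
  shows "\<exists>f \<in> E \<rightarrow>\<^sub>E {..<m}.
    (\<forall>v\<in>V. \<forall>i<m. real (card {e \<in> edges_at E v. f e = i}) \<le> (1 + \<epsilon>) * \<mu>) \<and>
    (\<forall>(u, v)\<in>Q. image_mset f (mset_set (edges_at E u)) \<noteq> image_mset f (mset_set (edges_at E v)))"
proof -
  define I where "I = (\<lambda>(v, i). Overfull v i) ` (V \<times> {..<m}) \<union> (\<lambda>(u, v). Clash u v) ` Q"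
  define prob where "prob j = (case j of Overfull v i \<Rightarrow> q | Clash u v \<Rightarrow> if {u, v} \<in> E then P k else P (Suc k))"
    for j
  define s where "s = 2 * (real m * q + 2 * (real N * P (Suc k) + real D * P k))"
  have "finite E" using E \<open>finite V\<close> by (intro finite_subset[of E "Pow V"]) auto
  have "finite Q" using Q(1) \<open>finite V\<close> by (intro finite_subset[OF Q(1)]) simp
  have nonneg: "0 \<le> q" "0 \<le> P j" for j by (simp_all add: q_def P_def)
  then have prob_nonneg: "0 \<le> prob j" for j by (simp add: prob_def split: event.split)
  have card2: "card e = 2" if "e \<in> E" for e using E that by blast
  have ends: "u \<in> V" "v \<in> V" "u \<noteq> v" if "(u, v) \<in> Q" for u v
    using that Q by (auto simp: irrefl_def)
  have "\<exists>f \<in> E \<rightarrow>\<^sub>E {..<m}. \<forall>j\<in>I. f \<notin> bad_splits E m ((1 + \<epsilon>) * \<mu>) j"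
  proof (rule lovasz_local_product[where D = "scope E" and p = prob and s = s and L = "2 * D"])
    show "finite I" using \<open>finite V\<close> \<open>finite Q\<close> by (simp add: I_def)
    show "0 \<le> s" using nonneg by (simp add: s_def)
    show "real (2 * D) * s \<le> 1/4" using small by (simp add: s_def)
    show "0 \<le> prob j" for j by (rule prob_nonneg)
    show "determined_by (scope E j) (E \<rightarrow>\<^sub>E {..<m}) (bad_splits E m ((1 + \<epsilon>) * \<mu>) j)" for j
      by (rule determined_by_bad_splits[OF \<open>finite E\<close>])
    show "scope E j \<subseteq> E" for j by (cases j) (auto simp: edges_at_def)
    fix j assume "j \<in> I"
    then consider v i where "j = Overfull v i" "v \<in> V" "i < m" | u v where "j = Clash u v" "(u, v) \<in> Q"
      by (auto simp: I_def)
    note j = this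
    show "scope E j \<noteq> {}" using j
    proof cases
      case 1
      then show ?thesis using deg(1)[of v] by auto
    next
      case 2
      then show ?thesis using deg(1)[of u] ends[of u v] by auto
    qed
    show "card (scope E j) \<le> 2 * D" using j
    proof cases
      case 1
      then show ?thesis using deg(2)[of v] by simp
    next
      case 2
      then show ?thesis
        using deg(2)[of u] deg(2)[of v] ends[of u v] card_Un_le[of "edges_at E u" "edges_at E v"] by simp
    qed
    show "real (card (bad_splits E m ((1 + \<epsilon>) * \<mu>) j)) \<le> prob j * real (card (E \<rightarrow>\<^sub>E {..<m}))" using j
    proof cases
      case 1
      have "real (card (edges_at E v)) \<le> \<mu> * real (card {..<m})"
        using deg(2)[OF 1(2)] \<mu> by simp
      from card_overfull_class_le[OF \<open>finite E\<close> _ _ _ \<open>\<epsilon> > 0\<close> this, of i] 1 show ?thesis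
        by (simp add: prob_def q_def edges_at_def)
    next
      case 2
      have "card (E \<inter> {{u, v}}) = (if {u, v} \<in> E then 1 else 0)" by simp
      then have "(if {u, v} \<in> E then k else Suc k) + card (E \<inter> {{u, v}}) \<le> card (edges_at E u)"
        using deg(1)[of u] ends[OF 2(2)] by auto
      from card_clash_le[OF \<open>finite E\<close> _ _ card2 ends(3)[OF 2(2)] this, of "{..<m}"] \<open>m > 0\<close> 2(1)
      show ?thesis by (auto simp: prob_def P_def lessThan_empty_iff split: if_splits)
    qed
  next
    fix e assume e: "e \<in> E"
    have finQ: "finite (Q `` {w})" for w using \<open>finite Q\<close> by simp
    \<comment> \<open>The events that see an edge with end \<open>w\<close>; a pair is listed from either of its ends.\<close>
    define T where "T w = Overfull w ` {..<m} \<union> (Clash w ` (Q `` {w}) \<union> (\<lambda>u. Clash u w) ` (Q `` {w}))" for w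
    have "{j. j \<in> I \<and> e \<in> scope E j} \<subseteq> (\<Union>w\<in>e. T w)"
    proof
      fix j assume j: "j \<in> {j. j \<in> I \<and> e \<in> scope E j}"
      show "j \<in> (\<Union>w\<in>e. T w)"
      proof (cases j)
        case (Overfull v i)
        with j show ?thesis by (auto simp: I_def T_def edges_at_def)
      next
        case (Clash u v)
        with j have "(u, v) \<in> Q" "u \<in> e \<or> v \<in> e" by (auto simp: I_def edges_at_def)
        moreover from this have "(v, u) \<in> Q" using Q(2) by (auto dest: symD)
        ultimately show ?thesis using Clash by (auto simp: T_def)
      qed
    qed
    moreover have "finite e" using card2[OF e] card_ge_0_finite[of e] by simp
    moreover have finT: "finite (T w)" for w using finQ by (simp add: T_def)
    ultimately have "(\<Sum>j | j \<in> I \<and> e \<in> scope E j. prob j) \<le> sum prob (\<Union>w\<in>e. T w)"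
      using prob_nonneg by (intro sum_mono2) auto
    also have "\<dots> \<le> (\<Sum>w\<in>e. sum prob (T w))"
      using \<open>finite e\<close> finT prob_nonneg by (intro sum_UN_le) auto
    also have "\<dots> \<le> (\<Sum>w\<in>e. real m * q + 2 * (real N * P (Suc k) + real D * P k))"
    proof (rule sum_mono)
      fix w assume "w \<in> e"
      then have "w \<in> V" using E e by blast
      define S where "S = (\<Sum>v\<in>Q `` {w}. if {v, w} \<in> E then P k else P (Suc k))"
      have "sum prob (Overfull w ` {..<m}) = real m * q"
        by (subst sum.reindex) (auto simp: inj_on_def prob_def)
      moreover have S: "S
          \<le> real N * P (Suc k) + real D * P k"
      proof -
        have "card {v. {v, w} \<in> E} \<le> D"
          using card_neighbours_eq_card_edges_at[of E w] card2 deg(2)[OF \<open>w \<in> V\<close>] by metis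
        moreover have "finite {v. {v, w} \<in> E}"
          using E by (intro finite_subset[OF _ \<open>finite V\<close>]) blast
        moreover have "{v \<in> Q `` {w}. {v, w} \<in> E} \<subseteq> {v. {v, w} \<in> E}" by auto
        ultimately have "card {v \<in> Q `` {w}. {v, w} \<in> E} \<le> D" by (meson card_mono le_trans)
        then have D: "real (card {v \<in> Q `` {w}. {v, w} \<in> E}) * P k \<le> real D * P k"
          using nonneg by (intro mult_right_mono) auto
        have "S \<le> (\<Sum>v\<in>Q `` {w}. P (Suc k) + (if {v, w} \<in> E then P k else 0))"
          unfolding S_def using nonneg by (intro sum_mono) auto
        also have "\<dots> = real (card (Q `` {w})) * P (Suc k)
            + real (card {v \<in> Q `` {w}. {v, w} \<in> E}) * P k"
          using finQ by (simp add: sum.distrib sum.If_cases Int_def)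
        also have "\<dots> \<le> real N * P (Suc k) + real D * P k"
          using Q(4)[of w] nonneg by (intro add_mono[OF mult_right_mono D]) auto
        finally show ?thesis .
      qed
      moreover have "sum prob (Clash w ` (Q `` {w})) = S"
        unfolding S_def by (subst sum.reindex) (auto simp: inj_on_def prob_def insert_commute)
      moreover have "sum prob ((\<lambda>u. Clash u w) ` (Q `` {w})) = S"
        unfolding S_def by (subst sum.reindex) (auto simp: inj_on_def prob_def)
      moreover have "sum prob (T w) \<le> sum prob (Overfull w ` {..<m})
          + (sum prob (Clash w ` (Q `` {w})) + sum prob ((\<lambda>u. Clash u w) ` (Q `` {w})))"
        unfolding T_def using finQ prob_nonneg
        by (intro order_trans[OF sum_Un_le] add_left_mono sum_Un_le) auto
      ultimately have "sum prob (T w) \<le> real m * q + (S + S)" by simp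
      with S show "sum prob (T w) \<le> real m * q + 2 * (real N * P (Suc k) + real D * P k)" by argo
    qed
    also have "\<dots> = s" using card2[OF e] by (simp add: s_def)
    finally show "(\<Sum>j | j \<in> I \<and> e \<in> scope E j. prob j) \<le> s" .
  qed (use \<open>finite E\<close> \<open>m > 0\<close> in auto)
  then obtain f where f: "f \<in> E \<rightarrow>\<^sub>E {..<m}" "\<And>j. j \<in> I \<Longrightarrow> f \<notin> bad_splits E m ((1 + \<epsilon>) * \<mu>) j"
    by blast
  show ?thesis
  proof (intro bexI[OF _ f(1)] conjI ballI allI impI, goal_cases)
    case (1 v i)
    then have "Overfull v i \<in> I" by (auto simp: I_def)
    from f(2)[OF this] f(1) show ?case by (simp add: not_less)
  next
    case (2 uv)
    then obtain u v where uv: "uv = (u, v)" "(u, v) \<in> Q" by (cases uv) auto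
    then have "Clash u v \<in> I" by (auto simp: I_def)
    from f(2)[OF this] f(1) uv(1) show ?case by simp
  qed
qed

section \<open>Vertices at bounded distance\<close>

lemma card_relpow_Image_le:
  fixes R :: "('v \<times> 'v) set"
  assumes "\<And>v. finite (R `` {v})" "\<And>v. card (R `` {v}) \<le> D"
  shows "finite ((R ^^ n) `` {v}) \<and> card ((R ^^ n) `` {v}) \<le> D ^ n"
proof (induction n)
  case (Suc n)
  have eq: "(R ^^ Suc n) `` {v} = (\<Union>w\<in>(R ^^ n) `` {v}. R `` {w})" by auto
  have "card ((R ^^ Suc n) `` {v}) \<le> (\<Sum>w\<in>(R ^^ n) `` {v}. card (R `` {w}))"
    unfolding eq using Suc by (intro card_UN_le) simp
  also have "\<dots> \<le> (\<Sum>w\<in>(R ^^ n) `` {v}. D)" using assms(2) by (intro sum_mono) simp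
  also have "\<dots> \<le> D ^ Suc n" using Suc by simp
  finally show ?case unfolding eq using assms(1) Suc by auto
qed simp

lemma sym_relpow: "sym R \<Longrightarrow> sym (R ^^ n)"
proof (induction n)
  case (Suc n)
  show ?case
  proof (rule symI)
    fix x z assume "(x, z) \<in> R ^^ Suc n"
    then obtain y where "(x, y) \<in> R ^^ n" "(y, z) \<in> R" by auto
    then have "(z, y) \<in> R" "(y, x) \<in> R ^^ n" using Suc by (auto dest: symD)
    then show "(z, x) \<in> R ^^ Suc n" by (rule relpow_Suc_I2)
  qed
qed (simp add: sym_Id)

text \<open>Relation powers are used for walks of a given length, since they give the bound \<open>D ^ n\<close> on the number of
  their ends by a simple induction.\<close>

definition adjacency :: "'v set set \<Rightarrow> ('v \<times> 'v) set" where
  "adjacency E = {(u, v). {u, v} \<in> E}"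

definition close_pairs :: "nat \<Rightarrow> 'v set set \<Rightarrow> ('v \<times> 'v) set" where
  "close_pairs r E = (\<Union>n\<in>{1..r}. adjacency E ^^ n) - Id"

lemma walk_relpow:
  "walk G p \<Longrightarrow> (hd p, last p) \<in> adjacency (edges G) ^^ (length p - 1)"
proof (induction p)
  case (Cons a p)
  show ?case
  proof (cases p)
    case (Cons b q)
    then have "walk G p" "(a, b) \<in> adjacency (edges G)"
      using Cons.prems by (auto simp: walk_def adjacency_def)
    with Cons.IH Cons have "(b, last p) \<in> adjacency (edges G) ^^ length q" by simp
    with \<open>(a, b) \<in> adjacency (edges G)\<close> have "(a, last p) \<in> adjacency (edges G) ^^ Suc (length q)"
      by (rule relpow_Suc_I2)
    with Cons show ?thesis by simp
  qed simp
qed (simp add: walk_def)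

lemma distance_close_pairs:
  assumes "u \<in> verts G" and "1 \<le> distance G u v" "distance G u v \<le> enat r"
  shows "(u, v) \<in> close_pairs r (edges G)"
proof -
  have "walk G [u]" using assms(1) by (simp add: walk_def)
  from distance_le_walk[OF this] have "distance G u u = 0" by (simp add: zero_enat_def[symmetric])
  with assms(2) have "u \<noteq> v" by auto
  define L where "L = {enat (length p - 1) | p. walk G p \<and> hd p = u \<and> last p = v}"
  have dist: "distance G u v = Inf L" by (simp add: distance_def L_def)
  with assms(3) have "L \<noteq> {}" by (auto simp: Inf_enat_def)
  then have "Inf L \<in> L" by (auto simp: Inf_enat_def intro: LeastI)
  then obtain p where p: "walk G p" "hd p = u" "last p = v" "distance G u v = enat (length p - 1)"
    using dist by (auto simp: L_def)
  have "(u, v) \<in> adjacency (edges G) ^^ (length p - 1)" using walk_relpow[OF p(1)] p by simp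
  moreover have "length p - 1 \<in> {1..r}" using p(4) assms by (simp add: one_enat_def)
  ultimately show ?thesis using \<open>u \<noteq> v\<close> unfolding close_pairs_def by blast
qed

lemma sym_close_pairs: "sym (close_pairs r E)"
proof (rule symI)
  fix u v assume "(u, v) \<in> close_pairs r E"
  then obtain n where n: "n \<in> {1..r}" "(u, v) \<in> adjacency E ^^ n" "u \<noteq> v"
    by (auto simp: close_pairs_def)
  have "sym (adjacency E)" by (auto simp: adjacency_def sym_def insert_commute)
  then have "(v, u) \<in> adjacency E ^^ n" using n(2) sym_relpow symD by metis
  with n show "(v, u) \<in> close_pairs r E" by (auto simp: close_pairs_def)
qed

lemma close_pairs_subset:
  assumes "\<And>e. e \<in> E \<Longrightarrow> e \<subseteq> V"
  shows "close_pairs r E \<subseteq> V \<times> V"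
proof -
  have "adjacency E ^^ Suc n \<subseteq> V \<times> V" for n
  proof (induction n)
    case (Suc n)
    have "adjacency E \<subseteq> V \<times> V" using assms by (fastforce simp: adjacency_def)
    with Suc show ?case by auto
  qed (use assms in \<open>fastforce simp: adjacency_def\<close>)
  then have "adjacency E ^^ n \<subseteq> V \<times> V" if "n \<in> {1..r}" for n
    using that by (cases n) auto
  then show ?thesis unfolding close_pairs_def by blast
qed

lemma card_close_pairs_le:
  assumes "finite V" and E: "\<And>e. e \<in> E \<Longrightarrow> e \<subseteq> V \<and> card e = 2"
    and deg: "\<And>v. card (edges_at E v) \<le> D" and "D \<ge> 1"
  shows "card (close_pairs r E `` {v}) \<le> r * D ^ r"
proof -
  have adj: "adjacency E `` {w} = {u. {u, w} \<in> E}" for w by (auto simp: adjacency_def insert_commute)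
  have fin: "finite (adjacency E `` {w})" for w
    unfolding adj using E by (intro finite_subset[OF _ \<open>finite V\<close>]) blast
  have le: "card (adjacency E `` {w}) \<le> D" for w
    using card_neighbours_eq_card_edges_at[of E w] E deg[of w] by (simp add: adj)
  note pow = card_relpow_Image_le[of "adjacency E", OF fin le]
  have "close_pairs r E `` {v} \<subseteq> (\<Union>n\<in>{1..r}. (adjacency E ^^ n) `` {v})"
    by (auto simp: close_pairs_def)
  then have "card (close_pairs r E `` {v}) \<le> card (\<Union>n\<in>{1..r}. (adjacency E ^^ n) `` {v})"
    using pow by (intro card_mono) auto
  also have "\<dots> \<le> (\<Sum>n\<in>{1..r}. card ((adjacency E ^^ n) `` {v}))" by (intro card_UN_le) simp
  also have "\<dots> \<le> (\<Sum>n\<in>{1..r}. D ^ r)"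
  proof (rule sum_mono)
    fix n assume "n \<in> {1..r}"
    then have "D ^ n \<le> D ^ r" using \<open>D \<ge> 1\<close> by (intro power_increasing) auto
    with pow[of n v] show "card ((adjacency E ^^ n) `` {v}) \<le> D ^ r" by linarith
  qed
  finally show ?thesis by simp
qed

section \<open>Colouring the classes from disjoint palettes\<close>

lemma degree_eq_card_edges_at:
  "simple_graph G \<Longrightarrow> degree G v = card (edges_at (edges G) v)"
  unfolding degree_def neighbours_def
  by (rule card_neighbours_eq_card_edges_at) (simp add: simple_graph_def)

lemma colours_at_eq_image:
  assumes "simple_graph G"
  shows "colours_at G c v = c ` edges_at (edges G) v"
proof -
  have "\<exists>u. e = {u, v}" if "e \<in> edges_at (edges G) v" for e
    using that assms by (auto simp: edges_at_def simple_graph_def card_2_iff dest!: bspec)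
  then show ?thesis unfolding colours_at_def neighbours_def edges_at_def by blast
qed

text \<open>Each class is coloured from a palette of its own, so the palette, and hence the class, of an edge can be
  read off from its colour. Consequently the set of colours at a vertex determines the multiset of the
  classes of its edges, and vertices with different multisets are distinguished.\<close>

lemma colouring_from_split:
  fixes G :: "'v graph" and f :: "'v set \<Rightarrow> nat"
  assumes G: "simple_graph G" and f: "f \<in> edges G \<rightarrow>\<^sub>E {..<m}"
    and small: "\<And>v i. v \<in> verts G \<Longrightarrow> i < m \<Longrightarrow> card {e \<in> edges_at (edges G) v. f e = i} \<le> d"
    and clash: "\<And>u v. (u, v) \<in> close_pairs r (edges G) \<Longrightarrow>
      image_mset f (mset_set (edges_at (edges G) u)) \<noteq> image_mset f (mset_set (edges_at (edges G) v))"
  shows "\<exists>c. proper_edge_colouring G (m * Suc d) c \<and> distinguishes r G c"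
proof -
  have E: "e \<subseteq> verts G" "card e = 2" if "e \<in> edges G" for e using G that by (auto simp: simple_graph_def)
  have "finite (edges G)"
    using G E by (intro finite_subset[of "edges G" "Pow (verts G)"]) (auto simp: simple_graph_def)
  have "\<exists>c. proper_on {e \<in> edges G. f e = i} (Suc d) c" if "i < m" for i
  proof (rule vizing)
    show "card {e \<in> {e \<in> edges G. f e = i}. v \<in> e} \<le> d" for v
    proof (cases "v \<in> verts G")
      case True
      have "{e \<in> {e \<in> edges G. f e = i}. v \<in> e} = {e \<in> edges_at (edges G) v. f e = i}"
        by (auto simp: edges_at_def)
      with small[OF True that] show ?thesis by simp
    next
      case False
      then have "{e \<in> {e \<in> edges G. f e = i}. v \<in> e} = {}" using E by blast
      then show ?thesis by (simp only: card.empty)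
    qed
  qed (use \<open>finite (edges G)\<close> E in auto)
  then obtain c' where c': "\<And>i. i < m \<Longrightarrow> proper_on {e \<in> edges G. f e = i} (Suc d) (c' i)" by metis
  define c where "c e = f e * Suc d + c' (f e) e + 1" for e
  have fm: "f e < m" if "e \<in> edges G" for e using f that by auto
  have lt: "c' (f e) e < Suc d" if "e \<in> edges G" for e
    using c'[OF fm[OF that]] that by (auto simp: proper_on_def)
  have f_c: "f e = (c e - 1) div Suc d" if "e \<in> edges G" for e
    using lt[OF that] by (simp add: c_def del: mult_Suc_right)
  have c_eq: "e = e'" if ee: "e \<in> edges G" "e' \<in> edges G" "v \<in> e" "v \<in> e'" "c e = c e'" for e e' v
  proof -
    have "f e = f e'" using f_c ee by metis
    moreover from this ee have "c' (f e) e = c' (f e) e'" by (simp add: c_def)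
    ultimately show ?thesis
      using proper_onD[OF c'[OF fm[OF ee(1)]], of e e' v] ee by simp
  qed
  have "proper_edge_colouring G (m * Suc d) c"
    unfolding proper_edge_colouring_def
  proof (intro conjI ballI impI)
    fix e assume e: "e \<in> edges G"
    have "c e \<le> f e * Suc d + Suc d" using lt[OF e] by (simp add: c_def)
    also have "\<dots> = Suc (f e) * Suc d" by simp
    also have "\<dots> \<le> m * Suc d" using fm[OF e] by (intro mult_le_mono1) simp
    finally show "c e \<in> {1..m * Suc d}" by (simp add: c_def)
  qed (use c_eq in blast)
  moreover have "distinguishes r G c"
    unfolding distinguishes_def
  proof (intro ballI impI notI)
    fix u v assume uv: "u \<in> verts G" "1 \<le> distance G u v \<and> distance G u v \<le> enat r"
      and eq: "colours_at G c u = colours_at G c v"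
    have *: "image_mset f (mset_set (edges_at (edges G) w))
        = image_mset (\<lambda>x. (x - 1) div Suc d) (mset_set (colours_at G c w))" for w
    proof -
      have inj: "inj_on c (edges_at (edges G) w)"
        by (rule inj_onI) (use c_eq in \<open>auto simp: edges_at_def\<close>)
      have "finite (edges_at (edges G) w)" using \<open>finite (edges G)\<close> by (simp add: edges_at_def)
      then have "image_mset f (mset_set (edges_at (edges G) w))
          = image_mset ((\<lambda>x. (x - 1) div Suc d) \<circ> c) (mset_set (edges_at (edges G) w))"
        by (intro image_mset_cong) (simp add: f_c edges_at_def)
      also have "\<dots> = image_mset (\<lambda>x. (x - 1) div Suc d) (mset_set (c ` edges_at (edges G) w))"
        by (simp add: image_mset_mset_set[OF inj, symmetric] multiset.map_comp)
      finally show ?thesis by (simp only: colours_at_eq_image[OF G])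
    qed
    from distance_close_pairs[OF uv(1), of v r] uv(2) clash[of u v] show False
      by (simp add: * eq)
  qed
  ultimately show ?thesis by blast
qed

section \<open>Large maximum degrees\<close>

lemma ln_power_over_self_tendsto_0: "((\<lambda>x::real. ln x ^ k / x) \<longlongrightarrow> 0) at_top" for k :: nat
proof -
  have "((\<lambda>x. ln x ^ k / exp (ln x)) \<longlongrightarrow> (0::real)) at_top"
    by (rule filterlim_compose[OF tendsto_power_div_exp_0 ln_at_top])
  moreover have "\<forall>\<^sub>F x::real in at_top. ln x ^ k / exp (ln x) = ln x ^ k / x"
    using eventually_gt_at_top[of 0] by eventually_elim simp
  ultimately show ?thesis by (rule Lim_transform_eventually)
qed

text \<open>The decay rate in the Chernoff bound.\<close>

lemma chernoff_rate_pos: "0 < (1 + \<epsilon>) * ln (1 + \<epsilon>) - \<epsilon>" if "0 < \<epsilon>" for \<epsilon> :: real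
proof -
  have "ln (1 / (1 + \<epsilon>)) < 1 / (1 + \<epsilon>) - 1"
    using that ln_le_minus_one[of "1 / (1 + \<epsilon>)"] ln_eq_minus_one[of "1 / (1 + \<epsilon>)"] by force
  then show ?thesis using that by (simp add: ln_div field_simps)
qed

text \<open>What has to be true of a large maximum degree \<open>x\<close> when the edges are split into about
  \<open>x / (ln x)\<^sup>2\<close> classes. The first inequality is the condition of the local lemma. The overfull classes
  contribute \<open>exp (- a * (ln x)\<^sup>2)\<close>, which beats every power of \<open>x\<close>; with a bounded \<open>\<mu>\<close> in place of
  \<open>(ln x)\<^sup>2\<close> this would fail. The second inequality says that the extra colour of each class
  in Vizing's theorem and the rounding of the number of classes cost at most \<open>\<epsilon> * x\<close> colours.\<close>

lemma eventually_split_sizes: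
  fixes r :: nat and \<epsilon> :: real
  assumes "\<epsilon> > 0"
  defines "a \<equiv> (1 + \<epsilon>) * ln (1 + \<epsilon>) - \<epsilon>"
  shows "\<forall>\<^sub>F x in at_top.
    4 * x\<^sup>2 * exp (- a * (ln x)\<^sup>2) + 8 * real r * fact (r + 2) * (ln x ^ (2 * (r + 2)) / x)
      + 8 * fact (r + 1) * (ln x ^ (2 * (r + 1)) / x) \<le> 1/4 \<and>
    (1 + \<epsilon>) * (ln x)\<^sup>2 + x / (ln x)\<^sup>2 + 1 \<le> \<epsilon> * x \<and> x / (ln x)\<^sup>2 + 1 \<le> x \<and> ln x \<ge> 1"
proof -
  have "a > 0" unfolding a_def by (rule chernoff_rate_pos) fact
  have lim1: "((\<lambda>x::real. 4 * x\<^sup>2 * exp (- a * (ln x)\<^sup>2)) \<longlongrightarrow> 0) at_top"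
    using \<open>a > 0\<close> by real_asymp
  have "((\<lambda>x. 4 * x\<^sup>2 * exp (- a * (ln x)\<^sup>2) + 8 * real r * fact (r + 2) * (ln x ^ (2 * (r + 2)) / x)
      + 8 * fact (r + 1) * (ln x ^ (2 * (r + 1)) / x)) \<longlongrightarrow> (0::real) + 8 * real r * fact (r + 2) * 0 + 8 * fact (r + 1) * 0) at_top"
    by (intro tendsto_add tendsto_mult tendsto_const lim1 ln_power_over_self_tendsto_0)
  then have ev1: "\<forall>\<^sub>F x in at_top. 4 * x\<^sup>2 * exp (- a * (ln x)\<^sup>2) + 8 * real r * fact (r + 2) * (ln x ^ (2 * (r + 2)) / x)
      + 8 * fact (r + 1) * (ln x ^ (2 * (r + 1)) / x) < 1/4"
    by (rule order_tendstoD) simp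
  have ev2: "\<forall>\<^sub>F x::real in at_top. (1 + \<epsilon>) * (ln x)\<^sup>2 + x / (ln x)\<^sup>2 + 1 \<le> \<epsilon> * x"
    using \<open>\<epsilon> > 0\<close> by real_asymp
  have ev3: "\<forall>\<^sub>F x::real in at_top. x / (ln x)\<^sup>2 + 1 \<le> x" by real_asymp
  have ev4: "\<forall>\<^sub>F x::real in at_top. ln x \<ge> 1" by real_asymp
  show ?thesis using ev1 ev2 ev3 ev4 by eventually_elim simp
qed

theorem theorem7:
  fixes r :: nat and \<eta> :: real
  assumes "r \<ge> 2" and "\<eta> > 0"
  shows "\<exists>\<Delta>\<^sub>0::nat. \<forall>G::'a graph.
           simple_graph G \<and> \<not> has_isolated_edge G \<and>
           min_degree G \<ge> r + 2 \<and> max_degree G \<ge> \<Delta>\<^sub>0 \<longrightarrow>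
           real (adj_strong_chromatic_index r G) \<le> (1 + \<eta>) * real (max_degree G)"
proof -
  define \<epsilon> where "\<epsilon> = \<eta> / 2"
  have "\<epsilon> > 0" using assms by (simp add: \<epsilon>_def)
  define a where "a = (1 + \<epsilon>) * ln (1 + \<epsilon>) - \<epsilon>"
  obtain \<Delta>\<^sub>0 :: nat where \<Delta>\<^sub>0: "\<And>n. n \<ge> \<Delta>\<^sub>0 \<Longrightarrow>
    4 * (real n)\<^sup>2 * exp (- a * (ln n)\<^sup>2) + 8 * real r * fact (r + 2) * (ln n ^ (2 * (r + 2)) / n)
      + 8 * fact (r + 1) * (ln n ^ (2 * (r + 1)) / n) \<le> 1/4 \<and>
    (1 + \<epsilon>) * (ln n)\<^sup>2 + n / (ln n)\<^sup>2 + 1 \<le> \<epsilon> * n \<and> n / (ln n)\<^sup>2 + 1 \<le> n \<and> ln n \<ge> 1"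
    using eventually_compose_filterlim[OF eventually_split_sizes[OF \<open>\<epsilon> > 0\<close>] filterlim_real_sequentially]
    unfolding eventually_sequentially a_def by blast
  show ?thesis
  proof (intro exI[of _ \<Delta>\<^sub>0] allI impI)
    fix G :: "'a graph"
    assume "simple_graph G \<and> \<not> has_isolated_edge G \<and> min_degree G \<ge> r + 2 \<and> max_degree G \<ge> \<Delta>\<^sub>0"
    then have G: "simple_graph G" and min: "min_degree G \<ge> r + 2" and max: "max_degree G \<ge> \<Delta>\<^sub>0" by auto
    define D where "D = max_degree G"
    define E where "E = edges G"
    have V: "finite (verts G)" "verts G \<noteq> {}" using G by (auto simp: simple_graph_def)
    have E: "e \<subseteq> verts G \<and> card e = 2" if "e \<in> E" for e using G that by (auto simp: simple_graph_def E_def)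
    have deg: "Suc (r + 1) \<le> card (edges_at E v)" "card (edges_at E v) \<le> D" if "v \<in> verts G" for v
    proof -
      have "min_degree G \<le> degree G v" "degree G v \<le> max_degree G"
        using V that by (auto simp: min_degree_def max_degree_def)
      with min show "Suc (r + 1) \<le> card (edges_at E v)" "card (edges_at E v) \<le> D"
        by (auto simp: degree_eq_card_edges_at[OF G] D_def E_def)
    qed
    have deg': "card (edges_at E v) \<le> D" for v
    proof (cases "v \<in> verts G")
      case False
      then have "edges_at E v = {}" using E by (auto simp: edges_at_def)
      then show ?thesis by (simp only: card.empty)
    qed (rule deg(2))
    \<comment> \<open>\<open>L\<close> is the mean size of a class at a vertex of maximum degree, up to rounding of \<open>m\<close>.\<close>
    define L where "L = (ln (real D))\<^sup>2"
    define m where "m = nat \<lceil>D / L\<rceil>"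
    note D = \<Delta>\<^sub>0[OF max, folded D_def]
    have "L \<ge> 1" using D by (simp add: L_def one_le_power)
    have "ln (real D) \<ge> 1" using D by blast
    have "D \<ge> 1" by (rule ccontr) (use \<open>ln (real D) \<ge> 1\<close> in \<open>simp add: not_le\<close>)
    have "D / L > 0" using \<open>L \<ge> 1\<close> \<open>D \<ge> 1\<close> by simp
    then have m: "D / L \<le> m" "m \<le> D / L + 1" "m > 0" unfolding m_def by linarith+
    have L_m: "real D \<le> L * real m" using m(1) \<open>L \<ge> 1\<close> by (simp add: field_simps)
    define P where "P = (\<lambda>j. fact j / real m ^ j)"
    have P: "P j \<le> fact j * L ^ j / real D ^ j" for j
    proof -
      have "real D ^ j \<le> L ^ j * real m ^ j"
        using power_mono[OF L_m, of j] by (simp add: power_mult_distrib)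
      then show ?thesis using \<open>m > 0\<close> \<open>D \<ge> 1\<close> by (simp add: P_def field_simps)
    qed
    have size: "real (2 * D) * (2 * (real m * exp (- a * L)
        + 2 * (real (r * D ^ r) * P (Suc (r + 1)) + real D * P (r + 1)))) \<le> 1/4"
    proof -
      have "real D * real m * exp (- a * L) \<le> (real D)\<^sup>2 * exp (- a * L)"
        using m(2) D by (auto simp: L_def power2_eq_square intro!: mult_left_mono mult_right_mono)
      moreover have "real D * (real (r * D ^ r) * P (Suc (r + 1))) \<le> real r * fact (r + 2) * (L ^ (r + 2) / D)"
      proof -
        have "real D * (real (r * D ^ r) * P (Suc (r + 1)))
            \<le> real D * (real (r * D ^ r) * (fact (r + 2) * L ^ (r + 2) / real D ^ (r + 2)))"
          using P[of "r + 2"] by (intro mult_left_mono) auto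
        also have "\<dots> = real r * fact (r + 2) * (L ^ (r + 2) / D)"
        proof -
          have "real D * (real r * y * (c * z / (y * (real D)\<^sup>2))) = real r * c * (z / D)"
            if "y \<noteq> 0" for y z c :: real
            using \<open>D \<ge> 1\<close> that by (simp add: field_simps power2_eq_square)
          from this[of "real D ^ r" "fact (r + 2)" "L ^ (r + 2)"] show ?thesis
            using \<open>D \<ge> 1\<close> by (simp only: power_add of_nat_mult of_nat_power) simp
        qed
        finally show ?thesis .
      qed
      moreover have "real D * (real D * P (r + 1)) \<le> fact (r + 1) * (L ^ (r + 1) / D)"
      proof -
        have "real D * (real D * P (r + 1))
            \<le> real D * (real D * (fact (r + 1) * L ^ (r + 1) / real D ^ (r + 1)))"
          using P[of "r + 1"] by (intro mult_left_mono) auto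
        also have "\<dots> = fact (r + 1) * L ^ (r + 1) * ((real D)\<^sup>2 / real D ^ (r + 1))"
          by (simp add: power2_eq_square)
        \<comment> \<open>For \<open>r = 1\<close> this bound on the clashes of adjacent vertices would not tend to 0.\<close>
        also have "(real D)\<^sup>2 / real D ^ (r + 1) \<le> 1 / D"
        proof -
          have "real D ^ 3 \<le> real D ^ (r + 1)"
            using \<open>D \<ge> 1\<close> \<open>r \<ge> 2\<close> by (intro power_increasing) auto
          then show ?thesis using \<open>D \<ge> 1\<close> by (simp add: divide_simps power2_eq_square power3_eq_cube)
        qed
        finally show ?thesis using \<open>L \<ge> 1\<close> by (simp add: mult_left_mono)
      qed
      moreover have "4 * (real D)\<^sup>2 * exp (- a * L) + 8 * real r * fact (r + 2) * (L ^ (r + 2) / D)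
          + 8 * fact (r + 1) * (L ^ (r + 1) / D) \<le> 1/4"
        using D by (simp only: L_def power_mult)
      moreover have "real (2 * D) * (2 * (x + 2 * (y + z))) = 4 * (real D * x) + 8 * (real D * y) + 8 * (real D * z)"
        for x y z by (simp add: algebra_simps)
      ultimately show ?thesis by (simp only: mult.assoc)
    qed
    have Q: "close_pairs r E \<subseteq> verts G \<times> verts G" "sym (close_pairs r E)" "irrefl (close_pairs r E)"
      "card (close_pairs r E `` {v}) \<le> r * D ^ r" for v
      using close_pairs_subset[of E "verts G" r] E sym_close_pairs
        card_close_pairs_le[OF V(1) E deg' \<open>D \<ge> 1\<close>]
      by (auto simp: irrefl_def close_pairs_def)
    obtain f where f: "f \<in> E \<rightarrow>\<^sub>E {..<m}"
      "\<And>v i. v \<in> verts G \<Longrightarrow> i < m \<Longrightarrow> real (card {e \<in> edges_at E v. f e = i}) \<le> (1 + \<epsilon>) * L"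
      "\<And>u v. (u, v) \<in> close_pairs r E \<Longrightarrow>
        image_mset f (mset_set (edges_at E u)) \<noteq> image_mset f (mset_set (edges_at E v))"
      using ex_distinguishing_split[OF V(1) E deg Q m(3) \<open>\<epsilon> > 0\<close> L_m, of] size
      unfolding P_def a_def by blast
    define d where "d = nat \<lfloor>(1 + \<epsilon>) * L\<rfloor>"
    have "\<exists>c. proper_edge_colouring G (m * Suc d) c \<and> distinguishes r G c"
    proof (rule colouring_from_split[OF G])
      show "card {e \<in> edges_at (edges G) v. f e = i} \<le> d" if "v \<in> verts G" "i < m" for v i
        using f(2)[OF that] unfolding d_def E_def by (simp add: le_nat_floor)
    qed (use f in \<open>auto simp: E_def\<close>)
    then have "adj_strong_chromatic_index r G \<le> m * Suc d"
      unfolding adj_strong_chromatic_index_def by (rule Least_le)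
    then have "real (adj_strong_chromatic_index r G) \<le> real m * (real d + 1)"
      by (metis of_nat_Suc of_nat_le_iff of_nat_mult add.commute)
    also have "\<dots> \<le> real m * ((1 + \<epsilon>) * L + 1)"
      using \<open>\<epsilon> > 0\<close> \<open>L \<ge> 1\<close> by (intro mult_left_mono) (auto simp: d_def)
    also have "\<dots> \<le> (D / L + 1) * ((1 + \<epsilon>) * L + 1)"
      using m(2) \<open>\<epsilon> > 0\<close> \<open>L \<ge> 1\<close> by (intro mult_right_mono) auto
    also have "\<dots> = (1 + \<epsilon>) * D + ((1 + \<epsilon>) * L + D / L + 1)"
      using \<open>L \<ge> 1\<close> by (simp add: field_simps)
    also have "\<dots> \<le> (1 + \<epsilon>) * D + \<epsilon> * D" using D by (simp add: L_def)
    also have "\<dots> = (1 + \<eta>) * D" by (simp add: \<epsilon>_def algebra_simps)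
    finally show "real (adj_strong_chromatic_index r G) \<le> (1 + \<eta>) * real (max_degree G)"
      by (simp add: D_def)
  qed
qed

end
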